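(* Let $n\geq 1$. For a finite simple connected graph $G$ let $s(G)$ be its sibling number and $t(G)$ its tuft number. Then the generating polynomial \[ \sum_{G} x^{s(G)}\,y^{t(G)}, \] where the sum is over all isomorphism classes (unlabeled graphs) $G$ of simple connected graphs with $n$ vertices, is symmetric in $x$ and $y$. Equivalently, the sibling number and the tuft number have joint symmetric distribution on unlabeled connected graphs with $n$ vertices.
   Context: All graphs are finite and simple. For a vertex $v$ of a graph $G$, its neighborhood is $N(v)=\{u : u \text{ adjacent to } v\}$ and its closed neighborhood is $N[v]=\{v\}\cup N(v)$. A leaf is a vertex of degree one. The tuft number $t(G)$ is the maximal number of leaves adjacent to a single vertex (it is $0$ if $G$ has no leaves). The sibling number is $s(G)=\max_{v\in V(G)}\lvert\{u\in V(G): N[u]=N[v]\}\rvert-1$. *)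

theory Defs
  imports Main
begin

text \<open>A finite simple graph on the vertex set {0..<n} is represented by its edge set:
  a set of 2-element subsets of {0..<n}.\<close>

definition simple_graphs :: "nat \<Rightarrow> nat set set set" where
  "simple_graphs n = {E. \<forall>e\<in>E. e \<subseteq> {..<n} \<and> card e = 2}"

definition nbhd :: "nat set set \<Rightarrow> nat \<Rightarrow> nat set" where
  "nbhd E v = {u. {u, v} \<in> E}"

definition closed_nbhd :: "nat set set \<Rightarrow> nat \<Rightarrow> nat set" where
  "closed_nbhd E v = insert v (nbhd E v)"

definition is_leaf :: "nat set set \<Rightarrow> nat \<Rightarrow> bool" where
  "is_leaf E v \<longleftrightarrow> card (nbhd E v) = 1"

definition connected_graph :: "nat \<Rightarrow> nat set set \<Rightarrow> bool" where
  "connected_graph n E \<longleftrightarrow>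
     (\<forall>u<n. \<forall>v<n. (u, v) \<in> {(a, b). {a, b} \<in> E}\<^sup>*)"

text \<open>Tuft number: maximal number of leaves adjacent to a single vertex (0 if no leaves).\<close>
definition tuft :: "nat \<Rightarrow> nat set set \<Rightarrow> nat" where
  "tuft n E = Max ({0} \<union> (\<lambda>v. card {u \<in> nbhd E v. is_leaf E u}) ` {..<n})"

text \<open>Sibling number: max over v of the number of u with N[u] = N[v], minus one.\<close>
definition sib :: "nat \<Rightarrow> nat set set \<Rightarrow> nat" where
  "sib n E = Max ({0} \<union> (\<lambda>v. card {u \<in> {..<n}. closed_nbhd E u = closed_nbhd E v}) ` {..<n}) - 1"

definition graph_iso :: "nat \<Rightarrow> nat set set \<Rightarrow> nat set set \<Rightarrow> bool" where
  "graph_iso n E E' \<longleftrightarrow> (\<exists>f. bij_betw f {..<n} {..<n} \<and> E' = (\<lambda>e. f ` e) ` E)"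

definition conn_graphs :: "nat \<Rightarrow> nat set set set" where
  "conn_graphs n = {E \<in> simple_graphs n. connected_graph n E}"

text \<open>Number of isomorphism classes (unlabeled graphs) of connected simple graphs on n
  vertices with sibling number a and tuft number b.\<close>
definition count_st :: "nat \<Rightarrow> nat \<Rightarrow> nat \<Rightarrow> nat" where
  "count_st n a b = card {{H \<in> conn_graphs n. graph_iso n G H} | G.
       G \<in> conn_graphs n \<and> sib n G = a \<and> tuft n G = b}"

end

theory Submission
  imports Defs "HOL-Library.Multiset" "HOL-Library.Nat_Bijection"
begin

text \<open>
Generalise to connected graphs with coloured vertices, where colour 0 is plain. Count isomorphism
types with a prescribed multiset \<open>M\<close> of colours in which classes of plain closed twins have at
most \<open>a + 1\<close> members and every plain vertex carries at most \<open>b\<close> plain leaves; call this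
number \<open>m a b M\<close>.

Let \<open>\<alpha>\<close>, \<open>\<beta>\<close> be fresh colours. A plain vertex with at least \<open>b + 1\<close> plain leaves can be
encoded as an \<open>\<alpha>\<close>-vertex with \<open>b + 1\<close> leaves fewer, and \<open>a + 2\<close> plain closed twins can be
encoded as one \<open>\<beta>\<close>-vertex. Doing this exhaustively is a bijection on isomorphism types, so the
number of all coloured connected graphs with colours \<open>M\<close> is the sum of \<open>m a b N\<close> over all
\<open>N\<close> that turn into \<open>M\<close> when each \<open>\<alpha>\<close> is replaced by \<open>b + 2\<close> and each \<open>\<beta>\<close> by
\<open>a + 2\<close> copies of 0. This index set does not change if \<open>a\<close> and \<open>b\<close> are exchanged
together with \<open>\<alpha>\<close> and \<open>\<beta>\<close>, and every \<open>N\<close> other than \<open>M\<close> has fewer plain vertices;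
induction on the number of plain vertices yields \<open>m a b M = m b a M\<close>. The connected graph with two plain
vertices must be excluded, since there each vertex is a leaf and a twin of the other.
\<close>

section \<open>Coloured connected graphs\<close>

text \<open>Each encoding is read off a simplified graph. Deleting the plain leaves and recording
  their number at every remaining vertex, or contracting twin classes and recording the multiset of
  colours of each, loses nothing up to isomorphism. The encoding is then a recolouring of single
  vertices: (0, m) with m > b becomes (\<alpha>, m - (b + 1)), once per vertex because the number of
  leaves left over is free, and the number of plain members of a twin class is divided with
  remainder by a + 2. So \<alpha> stands for b + 2 plain vertices, the stem included, and \<beta>
  for a + 2; that the two weights have the same form is what permits the exchange.

  The obstacle is interference: merging twins must not disturb the tuft bound already reached. Apart
  from the excluded graph, a plain vertex with a plain leaf has no other twin, and neither has the
  leaf. Hence tufts live on classes coloured \<open>{#0#}\<close>, which division by a + 2 leaves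
  alone.

  Upper bounds replace exact values throughout because the encodings remove excess; exact values
  return at the end by differencing.\<close>

record 'c cgraph =
  vs :: "nat set"
  ad :: "nat \<Rightarrow> nat \<Rightarrow> bool"
  cl :: "nat \<Rightarrow> 'c"

definition conn_cgraph :: "'c cgraph \<Rightarrow> bool" where
  "conn_cgraph G \<longleftrightarrow> finite (vs G) \<and>
     (\<forall>x y. ad G x y \<longrightarrow> x \<in> vs G \<and> y \<in> vs G \<and> x \<noteq> y \<and> ad G y x) \<and>
     (\<forall>x\<in>vs G. \<forall>y\<in>vs G. (ad G)\<^sup>*\<^sup>* x y)"

lemma conn_cgraphD:
  assumes "conn_cgraph G"
  shows "finite (vs G)"
    and "ad G x y \<Longrightarrow> x \<in> vs G" and "ad G x y \<Longrightarrow> y \<in> vs G"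
    and "ad G x y \<Longrightarrow> x \<noteq> y" and "ad G x y \<longleftrightarrow> ad G y x"
    and "x \<in> vs G \<Longrightarrow> y \<in> vs G \<Longrightarrow> (ad G)\<^sup>*\<^sup>* x y"
  using assms unfolding conn_cgraph_def by blast+

text \<open>Only values on the vertex sets are compared, so whatever \<open>cl\<close> does
  elsewhere is irrelevant; constructions below are therefore inverse up to isomorphism and not as
  records.\<close>

definition iso_map :: "(nat \<Rightarrow> nat) \<Rightarrow> 'c cgraph \<Rightarrow> 'c cgraph \<Rightarrow> bool" where
  "iso_map f G H \<longleftrightarrow> bij_betw f (vs G) (vs H) \<and>
     (\<forall>x\<in>vs G. \<forall>y\<in>vs G. ad H (f x) (f y) \<longleftrightarrow> ad G x y) \<and>
     (\<forall>x\<in>vs G. cl H (f x) = cl G x)"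

definition iso :: "'c cgraph \<Rightarrow> 'c cgraph \<Rightarrow> bool" (infix "\<approx>" 50) where
  "G \<approx> H \<longleftrightarrow> (\<exists>f. iso_map f G H)"

lemma iso_mapD:
  assumes "iso_map f G H"
  shows "bij_betw f (vs G) (vs H)" and "inj_on f (vs G)" and "f ` vs G = vs H"
    and "x \<in> vs G \<Longrightarrow> f x \<in> vs H"
    and "x \<in> vs G \<Longrightarrow> y \<in> vs G \<Longrightarrow> f x = f y \<longleftrightarrow> x = y"
    and "x \<in> vs G \<Longrightarrow> y \<in> vs G \<Longrightarrow> ad H (f x) (f y) \<longleftrightarrow> ad G x y"
    and "x \<in> vs G \<Longrightarrow> cl H (f x) = cl G x"
  using assms unfolding iso_map_def bij_betw_def inj_on_def by blast+

lemma iso_refl [simp]: "G \<approx> G"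
  unfolding iso_def iso_map_def by (rule exI[of _ id]) auto

lemma iso_map_inv:
  assumes "iso_map f G H" shows "iso_map (inv_into (vs G) f) H G"
proof -
  note f = iso_mapD[OF assms]
  let ?g = "inv_into (vs G) f"
  have g: "?g y \<in> vs G" "f (?g y) = y" if "y \<in> vs H" for y
    using that f(3) by (auto simp: inv_into_into f_inv_into_f)
  show ?thesis unfolding iso_map_def
    using bij_betw_inv_into[OF f(1)] g f(6,7) by metis
qed

lemma iso_sym: "G \<approx> H \<Longrightarrow> H \<approx> G"
  unfolding iso_def using iso_map_inv by blast

lemma iso_trans: assumes "G \<approx> H" "H \<approx> K" shows "G \<approx> K"
proof -
  from assms obtain f g where fg: "iso_map f G H" "iso_map g H K" unfolding iso_def by blast
  have "iso_map (g \<circ> f) G K"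
    unfolding iso_map_def
    using bij_betw_trans[OF iso_mapD(1)[OF fg(1)] iso_mapD(1)[OF fg(2)]]
    by (auto simp: iso_mapD(4,6,7)[OF fg(1)] iso_mapD(6,7)[OF fg(2)])
  then show ?thesis unfolding iso_def by blast
qed

section \<open>Isomorphism types and transfer of their number\<close>

definition types :: "'c cgraph set \<Rightarrow> 'c cgraph set set" where
  "types A = (\<lambda>G. {H. G \<approx> H}) ` A"

lemma iso_class_eq: "{H. G \<approx> H} = {H. G' \<approx> H} \<longleftrightarrow> G \<approx> G'"
  by (metis (mono_tags, lifting) Collect_cong iso_refl iso_sym iso_trans mem_Collect_eq)

text \<open>A relation that is total on both sides and matches the fibres of \<open>f\<close> with
  those of \<open>g\<close> descends to a bijection of the images. It is stated for a relation so
  that it also compares edge sets with coloured graphs of a different type at the end.\<close>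

lemma card_image_eq_rel:
  assumes "\<And>a. a \<in> A \<Longrightarrow> \<exists>b\<in>B. r a b" and "\<And>b. b \<in> B \<Longrightarrow> \<exists>a\<in>A. r a b"
    and "\<And>a b a' b'. a \<in> A \<Longrightarrow> a' \<in> A \<Longrightarrow> b \<in> B \<Longrightarrow> b' \<in> B \<Longrightarrow> r a b \<Longrightarrow> r a' b'
            \<Longrightarrow> f a = f a' \<longleftrightarrow> g b = g b'"
  shows "card (f ` A) = card (g ` B)"
proof -
  obtain \<phi> where \<phi>: "\<And>a. a \<in> A \<Longrightarrow> \<phi> a \<in> B \<and> r a (\<phi> a)" using assms(1) by metis
  define h where "h x = g (\<phi> (inv_into A f x))" for x
  have h: "h (f a) = g (\<phi> a)" if "a \<in> A" for a
  proof -
    have "inv_into A f (f a) \<in> A" "f (inv_into A f (f a)) = f a"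
      using that by (auto simp: inv_into_into f_inv_into_f)
    then show ?thesis unfolding h_def using assms(3) \<phi> that by metis
  qed
  have "bij_betw h (f ` A) (g ` B)"
    unfolding bij_betw_def
  proof
    show "inj_on h (f ` A)"
      by (rule inj_onI) (use h \<phi> assms(3) in \<open>smt (verit) imageE\<close>)
    have "g b \<in> h ` f ` A" if b: "b \<in> B" for b
    proof -
      obtain a where a: "a \<in> A" "r a b" using assms(2)[OF b] by blast
      have "g b = h (f a)" using assms(3)[of a a b "\<phi> a"] a \<phi> h b by auto
      then show ?thesis using a by blast
    qed
    then show "h ` f ` A = g ` B" using h \<phi> by auto
  qed
  then show ?thesis by (rule bij_betw_same_card)
qed

lemma card_types_eq:
  assumes "\<And>G. G \<in> A \<Longrightarrow> \<Phi> G \<in> B" and "\<And>H. H \<in> B \<Longrightarrow> \<Psi> H \<in> A"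
    and "\<And>G G'. G \<in> A \<Longrightarrow> G' \<in> A \<Longrightarrow> G \<approx> G' \<Longrightarrow> \<Phi> G \<approx> \<Phi> G'"
    and "\<And>H H'. H \<in> B \<Longrightarrow> H' \<in> B \<Longrightarrow> H \<approx> H' \<Longrightarrow> \<Psi> H \<approx> \<Psi> H'"
    and "\<And>G. G \<in> A \<Longrightarrow> \<Psi> (\<Phi> G) \<approx> G" and "\<And>H. H \<in> B \<Longrightarrow> \<Phi> (\<Psi> H) \<approx> H"
  shows "card (types A) = card (types B)"
  unfolding types_def
proof (rule card_image_eq_rel[where r = "\<lambda>G H. \<Phi> G \<approx> H"])
  show "\<exists>b\<in>B. \<Phi> a \<approx> b" if "a \<in> A" for a using assms(1) that iso_refl by blast
  show "\<exists>a\<in>A. \<Phi> a \<approx> b" if "b \<in> B" for b using assms(2,6) that by blast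
  fix G H G' H' assume *: "G \<in> A" "G' \<in> A" "H \<in> B" "H' \<in> B" "\<Phi> G \<approx> H" "\<Phi> G' \<approx> H'"
  have "G \<approx> G'" if "H \<approx> H'"
  proof -
    have "\<Phi> G \<approx> \<Phi> G'" using * that iso_sym iso_trans by meson
    then have "\<Psi> (\<Phi> G) \<approx> \<Psi> (\<Phi> G')" using assms(1,4) * by blast
    then show ?thesis using assms(5) * iso_sym iso_trans by meson
  qed
  moreover have "H \<approx> H'" if "G \<approx> G'"
    using assms(3) * that iso_sym iso_trans by meson
  ultimately show "{H. G \<approx> H} = {H. G' \<approx> H} \<longleftrightarrow> {Ha. H \<approx> Ha} = {H. H' \<approx> H}"
    unfolding iso_class_eq by blast
qed

definition recolor :: "('c \<Rightarrow> 'd) \<Rightarrow> 'c cgraph \<Rightarrow> 'd cgraph" where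
  "recolor \<theta> G = \<lparr>vs = vs G, ad = ad G, cl = \<theta> \<circ> cl G\<rparr>"

lemma recolor_simps [simp]:
  "vs (recolor \<theta> G) = vs G" "ad (recolor \<theta> G) = ad G" "cl (recolor \<theta> G) = \<theta> \<circ> cl G"
  by (simp_all add: recolor_def)

lemma recolor_iso: "G \<approx> H \<Longrightarrow> recolor \<theta> G \<approx> recolor \<theta> H"
  unfolding iso_def iso_map_def by auto

lemma conn_recolor [simp]: "conn_cgraph (recolor \<theta> G) \<longleftrightarrow> conn_cgraph G"
  by (simp add: conn_cgraph_def)

lemma recolor_recolor_iso:
  assumes "\<And>v. v \<in> vs K \<Longrightarrow> \<theta>' (\<theta> (cl K v)) = cl K v"
  shows "recolor \<theta>' (recolor \<theta> K) \<approx> K"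
  unfolding iso_def iso_map_def by (rule exI[of _ id]) (use assms in auto)

text \<open>Common frame of both encodings: \<open>core\<close> and \<open>build\<close> are inverse
  up to isomorphism, and all the combinatorics sits in the colour maps \<theta> and \<theta>'. These
  need to be inverse only on colours that occur in cores from \<open>A'\<close> and
  \<open>B'\<close>, which is where freshness of the new colour and the bounds enter.\<close>

lemma card_types_eq_via_core:
  fixes core :: "'c cgraph \<Rightarrow> 'd cgraph"
  assumes core: "\<And>G. G \<in> \<G> \<Longrightarrow> core G \<in> \<K>" "\<And>G H. G \<in> \<G> \<Longrightarrow> H \<in> \<G> \<Longrightarrow> G \<approx> H \<Longrightarrow> core G \<approx> core H"
    and build: "\<And>K. K \<in> \<K> \<Longrightarrow> build K \<in> \<G>" "\<And>K L. K \<in> \<K> \<Longrightarrow> L \<in> \<K> \<Longrightarrow> K \<approx> L \<Longrightarrow> build K \<approx> build L"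
    and inv: "\<And>G. G \<in> \<G> \<Longrightarrow> build (core G) \<approx> G" "\<And>K. K \<in> \<K> \<Longrightarrow> core (build K) \<approx> K"
    and AB: "\<And>K L. K \<in> \<K> \<Longrightarrow> L \<in> \<K> \<Longrightarrow> K \<approx> L \<Longrightarrow> K \<in> A' \<Longrightarrow> L \<in> A'"
            "\<And>K L. K \<in> \<K> \<Longrightarrow> L \<in> \<K> \<Longrightarrow> K \<approx> L \<Longrightarrow> K \<in> B' \<Longrightarrow> L \<in> B'"
    and \<theta>: "\<And>K. K \<in> \<K> \<Longrightarrow> K \<in> A' \<Longrightarrow> recolor \<theta> K \<in> \<K> \<inter> B'"
           "\<And>K v. K \<in> \<K> \<Longrightarrow> K \<in> A' \<Longrightarrow> v \<in> vs K \<Longrightarrow> \<theta>' (\<theta> (cl K v)) = cl K v"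
           "\<And>K. K \<in> \<K> \<Longrightarrow> K \<in> B' \<Longrightarrow> recolor \<theta>' K \<in> \<K> \<inter> A'"
           "\<And>K v. K \<in> \<K> \<Longrightarrow> K \<in> B' \<Longrightarrow> v \<in> vs K \<Longrightarrow> \<theta> (\<theta>' (cl K v)) = cl K v"
  shows "card (types {G \<in> \<G>. core G \<in> A'}) = card (types {G \<in> \<G>. core G \<in> B'})"
proof (rule card_types_eq[where \<Phi> = "\<lambda>G. build (recolor \<theta> (core G))"
        and \<Psi> = "\<lambda>G. build (recolor \<theta>' (core G))"])
  have step: "build (recolor \<eta> (core G)) \<in> {G \<in> \<G>. core G \<in> Q}"
    if "G \<in> {G \<in> \<G>. core G \<in> P}" "\<And>K. K \<in> \<K> \<Longrightarrow> K \<in> P \<Longrightarrow> recolor \<eta> K \<in> \<K> \<inter> Q"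
      "\<And>K L. K \<in> \<K> \<Longrightarrow> L \<in> \<K> \<Longrightarrow> K \<approx> L \<Longrightarrow> K \<in> Q \<Longrightarrow> L \<in> Q"
    for G P Q \<eta>
  proof -
    have "recolor \<eta> (core G) \<in> \<K> \<inter> Q" using that core by blast
    then show ?thesis using build(1) core(1) inv(2) iso_sym that(3) by blast
  qed
  have backward: "build (recolor \<eta>' (core (build (recolor \<eta> (core G))))) \<approx> G"
    if "G \<in> {G \<in> \<G>. core G \<in> P}" "\<And>K. K \<in> \<K> \<Longrightarrow> K \<in> P \<Longrightarrow> recolor \<eta> K \<in> \<K> \<inter> Q"
      "\<And>K. K \<in> \<K> \<Longrightarrow> K \<in> Q \<Longrightarrow> recolor \<eta>' K \<in> \<K> \<inter> P"
      "\<And>K v. K \<in> \<K> \<Longrightarrow> K \<in> P \<Longrightarrow> v \<in> vs K \<Longrightarrow> \<eta>' (\<eta> (cl K v)) = cl K v"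
      "\<And>K L. K \<in> \<K> \<Longrightarrow> L \<in> \<K> \<Longrightarrow> K \<approx> L \<Longrightarrow> K \<in> Q \<Longrightarrow> L \<in> Q"
    for G P Q \<eta> \<eta>'
  proof -
    let ?K = "core G"
    have K: "?K \<in> \<K>" "?K \<in> P" using that core by auto
    have L: "recolor \<eta> ?K \<in> \<K>" "recolor \<eta> ?K \<in> Q" using that(2) K by auto
    \<comment> \<open>Taking the core of the rebuilt graph returns the recoloured core only up to
      isomorphism, so membership in \<open>Q\<close> has to be carried across before \<eta>' may be
      applied.\<close>
    let ?L = "core (build (recolor \<eta> ?K))"
    have L2: "?L \<in> \<K>" "?L \<approx> recolor \<eta> ?K" using L core build inv by auto
    then have "?L \<in> Q" using that(5) L iso_sym by blast
    then have R: "recolor \<eta>' ?L \<in> \<K>" using L2 that(3) by blast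
    have "recolor \<eta>' ?L \<approx> recolor \<eta>' (recolor \<eta> ?K)" using L2 recolor_iso by blast
    also have 1: "recolor \<eta>' (recolor \<eta> ?K) \<approx> ?K" using recolor_recolor_iso that(4) K by blast
    finally (iso_trans) have "build (recolor \<eta>' ?L) \<approx> build ?K"
      using build(2) R K by blast
    then show ?thesis using inv(1) that(1) iso_trans by blast
  qed
  show "build (recolor \<theta> (core G)) \<in> {G \<in> \<G>. core G \<in> B'}" if "G \<in> {G \<in> \<G>. core G \<in> A'}" for G
    by (rule step[where P = A', OF that]) (fact \<theta>(1) AB(2))+
  show "build (recolor \<theta>' (core G)) \<in> {G \<in> \<G>. core G \<in> A'}" if "G \<in> {G \<in> \<G>. core G \<in> B'}" for G
    by (rule step[where P = B', OF that]) (fact \<theta>(3) AB(1))+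
  have cong: "build (recolor \<eta> (core G)) \<approx> build (recolor \<eta> (core G'))"
    if "G \<in> {G \<in> \<G>. core G \<in> P}" "G' \<in> {G \<in> \<G>. core G \<in> P}" "G \<approx> G'"
      "\<And>K. K \<in> \<K> \<Longrightarrow> K \<in> P \<Longrightarrow> recolor \<eta> K \<in> \<K> \<inter> Q" for G G' P Q \<eta>
    by (rule build(2)) (use that core recolor_iso in blast)+
  show "build (recolor \<theta> (core G)) \<approx> build (recolor \<theta> (core G'))"
    if "G \<in> {G \<in> \<G>. core G \<in> A'}" "G' \<in> {G \<in> \<G>. core G \<in> A'}" "G \<approx> G'" for G G'
    by (rule cong[where P = A' and Q = B', OF that]) (fact \<theta>(1))
  show "build (recolor \<theta>' (core G)) \<approx> build (recolor \<theta>' (core G'))"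
    if "G \<in> {G \<in> \<G>. core G \<in> B'}" "G' \<in> {G \<in> \<G>. core G \<in> B'}" "G \<approx> G'" for G G'
    by (rule cong[where P = B' and Q = A', OF that]) (fact \<theta>(3))
  show "build (recolor \<theta>' (core (build (recolor \<theta> (core G))))) \<approx> G"
    if "G \<in> {G \<in> \<G>. core G \<in> A'}" for G
    by (rule backward[where P = A' and Q = B', OF that]) (fact \<theta>(1) \<theta>(3) \<theta>(2) AB(2))+
  show "build (recolor \<theta> (core (build (recolor \<theta>' (core G))))) \<approx> G"
    if "G \<in> {G \<in> \<G>. core G \<in> B'}" for G
    by (rule backward[where P = B' and Q = A', OF that]) (fact \<theta>(3) \<theta>(1) \<theta>(4) AB(1))+
qed

section \<open>Colour contents\<close>

definition content :: "'c cgraph \<Rightarrow> 'c multiset" where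
  "content G = image_mset (cl G) (mset_set (vs G))"

lemma content_recolor [simp]: "content (recolor \<theta> G) = image_mset \<theta> (content G)"
  by (simp add: content_def multiset.map_comp)

lemma content_iso: assumes "G \<approx> H" shows "content G = content H"
proof -
  from assms obtain f where "iso_map f G H" unfolding iso_def by blast
  note f = iso_mapD[OF this]
  have "content H = image_mset (cl H) (image_mset f (mset_set (vs G)))"
    by (simp add: content_def image_mset_mset_set f(2,3))
  also have "\<dots> = image_mset (cl G) (mset_set (vs G))"
    unfolding multiset.map_comp
    by (rule image_mset_cong) (metis comp_apply f(7) elem_mset_set mset_set.infinite empty_iff set_mset_empty)
  finally show ?thesis by (simp add: content_def)
qed

lemma in_content: "finite (vs G) \<Longrightarrow> c \<in># content G \<longleftrightarrow> (\<exists>v\<in>vs G. cl G v = c)"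
  by (auto simp: content_def)

section \<open>Tufts and closed twins in coloured graphs\<close>

definition zleaf :: "'c \<Rightarrow> 'c cgraph \<Rightarrow> nat \<Rightarrow> bool" where
  "zleaf z G v \<longleftrightarrow> v \<in> vs G \<and> cl G v = z \<and> (\<exists>!w. ad G v w)"

text \<open>The plain colour is a parameter because it changes with the colour type: 0 in a graph,
  \<open>{#0#}\<close> in its twin quotient. Stems of other colours are left unrestricted, so an
  encoded stem may keep any number of leaves.\<close>

definition tuft_bounded :: "'c \<Rightarrow> nat \<Rightarrow> 'c cgraph \<Rightarrow> bool" where
  "tuft_bounded z b G \<longleftrightarrow> (\<forall>v\<in>vs G. cl G v = z \<longrightarrow> card {u. ad G v u \<and> zleaf z G u} \<le> b)"

definition cnb :: "'c cgraph \<Rightarrow> nat \<Rightarrow> nat set" where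
  "cnb G v = insert v {u. ad G u v}"

text \<open>The bound is \<open>Suc a\<close> because the sibling number is the size of a class
  minus one.\<close>

definition twin_bounded :: "nat \<Rightarrow> nat cgraph \<Rightarrow> bool" where
  "twin_bounded a G \<longleftrightarrow> (\<forall>v\<in>vs G. cl G v = 0 \<longrightarrow>
     card {u\<in>vs G. cl G u = 0 \<and> cnb G u = cnb G v} \<le> Suc a)"

lemma ex1_iff_card: "(\<exists>!w. P w) \<longleftrightarrow> card {w. P w} = 1"
  unfolding One_nat_def card_1_singleton_iff set_eq_iff mem_Collect_eq singleton_iff by metis

lemma zleaf_iso_map:
  assumes "iso_map f G H" "conn_cgraph G" "conn_cgraph H" "v \<in> vs G"
  shows "zleaf z H (f v) \<longleftrightarrow> zleaf z G v"
proof -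
  note f = iso_mapD[OF assms(1)]
  note G = conn_cgraphD[OF assms(2)] and H = conn_cgraphD[OF assms(3)]
  have nb: "{w. ad H (f v) w} = f ` {w. ad G v w}"
  proof (rule set_eqI, rule iffI)
    fix w assume w: "w \<in> {w. ad H (f v) w}"
    then obtain u where u: "w = f u" "u \<in> vs G" using f(3) H(3) by blast
    then show "w \<in> f ` {w. ad G v w}" using w f(6)[OF assms(4)] by blast
  next
    fix w assume "w \<in> f ` {w. ad G v w}"
    then obtain u where u: "w = f u" "ad G v u" by blast
    then show "w \<in> {w. ad H (f v) w}" using f(6)[OF assms(4) G(3)] by simp
  qed
  have "inj_on f {w. ad G v w}" using f(2) by (rule inj_on_subset) (use G(3) in blast)
  then have "card {w. ad H (f v) w} = card {w. ad G v w}" by (simp add: nb card_image)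
  then show ?thesis unfolding zleaf_def ex1_iff_card using f(4,7) assms(4) by simp
qed

lemma tuft_set_iso_map:
  assumes "iso_map f G H" "conn_cgraph G" "conn_cgraph H" "v \<in> vs G"
  shows "card {u. ad H (f v) u \<and> zleaf z H u} = card {u. ad G v u \<and> zleaf z G u}"
proof -
  note f = iso_mapD[OF assms(1)]
  note G = conn_cgraphD[OF assms(2)] and H = conn_cgraphD[OF assms(3)]
  have "{u. ad H (f v) u \<and> zleaf z H u} = f ` {u. ad G v u \<and> zleaf z G u}" (is "?L = f ` ?R")
  proof (rule set_eqI, rule iffI)
    fix u assume u: "u \<in> ?L"
    then obtain w where w: "u = f w" "w \<in> vs G" using f(3) H(3) by blast
    then show "u \<in> f ` ?R" using u zleaf_iso_map[OF assms(1-3)] f(6) assms(4) by blast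
  next
    fix u assume "u \<in> f ` ?R"
    then obtain w where w: "u = f w" "ad G v w" "zleaf z G w" by blast
    then have "w \<in> vs G" by (simp add: zleaf_def)
    then show "u \<in> ?L" using w zleaf_iso_map[OF assms(1-3)] f(6) assms(4) by blast
  qed
  moreover have "inj_on f ?R" using f(2) by (rule inj_on_subset) (auto simp: zleaf_def)
  ultimately show ?thesis by (simp add: card_image)
qed

lemma tuft_bounded_iso:
  assumes "G \<approx> H" "conn_cgraph G" "conn_cgraph H"
  shows "tuft_bounded z b G \<longleftrightarrow> tuft_bounded z b H"
proof -
  from assms obtain f where f: "iso_map f G H" unfolding iso_def by blast
  have "tuft_bounded z b H \<longleftrightarrow> (\<forall>v\<in>vs G. cl H (f v) = z \<longrightarrow> card {u. ad H (f v) u \<and> zleaf z H u} \<le> b)"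
    unfolding tuft_bounded_def iso_mapD(3)[OF f, symmetric] by blast
  then show ?thesis
    unfolding tuft_bounded_def using tuft_set_iso_map[OF f assms(2,3)] iso_mapD(7)[OF f] by auto
qed

lemma cnb_iso_map:
  assumes "iso_map f G H" "conn_cgraph G" "conn_cgraph H" "v \<in> vs G"
  shows "cnb H (f v) = f ` cnb G v"
proof -
  note f = iso_mapD[OF assms(1)]
  have "u \<in> cnb H (f v) \<longleftrightarrow> u \<in> f ` cnb G v" for u
    unfolding cnb_def using f(3,6) conn_cgraphD(2)[OF assms(2)] conn_cgraphD(2)[OF assms(3)] assms(4)
    by (smt (verit, best) image_iff insert_iff mem_Collect_eq)
  then show ?thesis by blast
qed

lemma cnb_subset: "conn_cgraph G \<Longrightarrow> v \<in> vs G \<Longrightarrow> cnb G v \<subseteq> vs G"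
  unfolding cnb_def using conn_cgraphD(2) by fastforce

lemma cnb_eq_iso_map:
  assumes "iso_map f G H" "conn_cgraph G" "conn_cgraph H" "v \<in> vs G" "w \<in> vs G"
  shows "cnb H (f v) = cnb H (f w) \<longleftrightarrow> cnb G v = cnb G w"
  unfolding cnb_iso_map[OF assms(1-4)] cnb_iso_map[OF assms(1-3,5)]
  using inj_on_image_eq_iff[OF iso_mapD(2)[OF assms(1)]] cnb_subset assms by metis

section \<open>Transport of connectedness\<close>

lemma rtranclp_map:
  assumes "r\<^sup>*\<^sup>* x y" and "\<And>x y. r x y \<Longrightarrow> f x = f y \<or> s (f x) (f y)"
  shows "s\<^sup>*\<^sup>* (f x) (f y)"
  using assms(1)
proof induction
  case (step y z)
  then show ?case using assms(2)[of y z] by (auto intro: rtranclp.rtrancl_into_rtrancl)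
qed simp

text \<open>For graphs obtained by inflating \<open>K\<close>: walks of \<open>K\<close> are carried
  over by \<open>e\<close>, and every vertex is at distance at most one from the copy of
  \<open>K\<close>.\<close>

lemma conn_via_retract:
  assumes "finite (vs G)"
    and "\<And>x y. ad G x y \<Longrightarrow> x \<in> vs G \<and> y \<in> vs G \<and> x \<noteq> y \<and> ad G y x"
    and K: "conn_cgraph K"
    and "\<And>v w. ad K v w \<Longrightarrow> ad G (e v) (e w)"
    and "\<And>x. x \<in> vs G \<Longrightarrow> r x \<in> vs K \<and> (x = e (r x) \<or> ad G x (e (r x)))"
  shows "conn_cgraph G"
  unfolding conn_cgraph_def
proof (intro conjI ballI)
  show "finite (vs G)" by fact
  show "\<forall>x y. ad G x y \<longrightarrow> x \<in> vs G \<and> y \<in> vs G \<and> x \<noteq> y \<and> ad G y x" using assms(2) by blast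
  fix x y assume x: "x \<in> vs G" and y: "y \<in> vs G"
  have "(ad K)\<^sup>*\<^sup>* (r x) (r y)" using conn_cgraphD(6)[OF K] assms(5) x y by blast
  then have "(ad G)\<^sup>*\<^sup>* (e (r x)) (e (r y))" by (rule rtranclp_map) (use assms(4) in blast)
  moreover have "(ad G)\<^sup>*\<^sup>* x (e (r x))" using assms(5)[OF x] by auto
  moreover have "(ad G)\<^sup>*\<^sup>* (e (r y)) y" using assms(5)[OF y] assms(2) by auto
  ultimately show "(ad G)\<^sup>*\<^sup>* x y" by auto
qed

text \<open>For the reverse direction, induced subgraphs obtained by deleting leaves or twins:
  applying \<open>r\<close> to a walk of \<open>G\<close> gives a walk of \<open>K\<close>, possibly
  with pauses.\<close>

lemma conn_induced:
  assumes G: "conn_cgraph G" and "vs K \<subseteq> vs G"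
    and "\<And>x y. ad K x y \<longleftrightarrow> x \<in> vs K \<and> y \<in> vs K \<and> ad G x y"
    and "\<And>x. x \<in> vs K \<Longrightarrow> r x = x"
    and "\<And>x y. ad G x y \<Longrightarrow> r x = r y \<or> ad K (r x) (r y)"
  shows "conn_cgraph K"
  unfolding conn_cgraph_def
proof (intro conjI ballI)
  show "finite (vs K)" using conn_cgraphD(1)[OF G] assms(2) finite_subset by blast
  show "\<forall>x y. ad K x y \<longrightarrow> x \<in> vs K \<and> y \<in> vs K \<and> x \<noteq> y \<and> ad K y x"
    using assms(3) conn_cgraphD(4,5)[OF G] by blast
  fix x y assume x: "x \<in> vs K" and y: "y \<in> vs K"
  have "(ad G)\<^sup>*\<^sup>* x y" using conn_cgraphD(6)[OF G] x y assms(2) by blast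
  then have "(ad K)\<^sup>*\<^sup>* (r x) (r y)" by (rule rtranclp_map) (use assms(5) in blast)
  then show "(ad K)\<^sup>*\<^sup>* x y" using x y assms(4) by simp
qed

section \<open>Absorbing plain leaves\<close>

text \<open>No walk leaves \<open>S\<close>. This is how graphs with one or two vertices, the
  degenerate cases, are recognised.\<close>

lemma closed_set_eq_vs:
  assumes G: "conn_cgraph G" and "x \<in> S" "S \<subseteq> vs G"
    and "\<And>u v. u \<in> S \<Longrightarrow> ad G u v \<Longrightarrow> v \<in> S"
  shows "vs G = S"
proof
  show "vs G \<subseteq> S"
  proof
    fix y assume "y \<in> vs G"
    then have "(ad G)\<^sup>*\<^sup>* x y" using conn_cgraphD(6)[OF G] assms(2,3) by blast
    then show "y \<in> S" by induction (use assms in auto)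
  qed
qed fact

lemma content_sum: "content G = (\<Sum>v\<in>vs G. {#cl G v#})"
proof (cases "finite (vs G)")
  case True
  have "finite S \<Longrightarrow> image_mset (cl G) (mset_set S) = (\<Sum>v\<in>S. {#cl G v#})" for S
    by (induction S rule: finite_induct) auto
  then show ?thesis using True by (simp add: content_def)
qed (simp add: content_def)

lemma sum_mset_content: "(\<Sum>d\<in>#content G. w d) = (\<Sum>v\<in>vs G. w (cl G v))"
  by (simp add: content_def sum_unfold_sum_mset multiset.map_comp comp_def)

definition stem :: "'c cgraph \<Rightarrow> nat \<Rightarrow> nat" where
  "stem G u = (THE w. ad G u w)"

lemma stem:
  assumes "zleaf z G u" shows "ad G u w \<longleftrightarrow> w = stem G u"
proof -
  have "\<exists>!w. ad G u w" using assms by (simp add: zleaf_def)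
  then show ?thesis unfolding stem_def by (metis theI_unique)
qed

definition leaves_at :: "nat cgraph \<Rightarrow> nat \<Rightarrow> nat set" where
  "leaves_at G v = {u. ad G v u \<and> zleaf 0 G u}"

text \<open>All plain leaves are deleted, also those at stems that are not plain, so that the second
  component of the new colour is the full number of plain leaves.\<close>

definition tcore :: "nat cgraph \<Rightarrow> (nat \<times> nat) cgraph" where
  "tcore G = \<lparr>vs = {v \<in> vs G. \<not> zleaf 0 G v},
     ad = (\<lambda>x y. ad G x y \<and> \<not> zleaf 0 G x \<and> \<not> zleaf 0 G y),
     cl = (\<lambda>v. (cl G v, card (leaves_at G v)))\<rparr>"

lemma tcore_simps [simp]:
  "vs (tcore G) = {v \<in> vs G. \<not> zleaf 0 G v}"
  "ad (tcore G) x y \<longleftrightarrow> ad G x y \<and> \<not> zleaf 0 G x \<and> \<not> zleaf 0 G y"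
  "cl (tcore G) v = (cl G v, card (leaves_at G v))"
  by (simp_all add: tcore_def)

text \<open>The code of \<open>(v, 0)\<close> is the old vertex \<open>v\<close>; the codes of
  \<open>(v, i)\<close> with \<open>i > 0\<close> are the leaves attached to it. Two codes over the
  same \<open>v\<close> are adjacent exactly if one of them has index 0.\<close>

definition tattach :: "(nat \<times> nat) cgraph \<Rightarrow> nat cgraph" where
  "tattach K = \<lparr>vs = prod_encode ` (SIGMA v:vs K. {..snd (cl K v)}),
     ad = (\<lambda>x y. case (prod_decode x, prod_decode y) of ((v, i), (w, j)) \<Rightarrow>
        v \<in> vs K \<and> w \<in> vs K \<and> i \<le> snd (cl K v) \<and> j \<le> snd (cl K w) \<and>
        (i = 0 \<and> j = 0 \<and> ad K v w \<or> v = w \<and> (i = 0) \<noteq> (j = 0))),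
     cl = (\<lambda>x. case prod_decode x of (v, i) \<Rightarrow> if i = 0 then fst (cl K v) else 0)\<rparr>"

lemma tattach_simps [simp]:
  "prod_encode (v, i) \<in> vs (tattach K) \<longleftrightarrow> v \<in> vs K \<and> i \<le> snd (cl K v)"
  "ad (tattach K) (prod_encode (v, i)) (prod_encode (w, j)) \<longleftrightarrow>
     v \<in> vs K \<and> w \<in> vs K \<and> i \<le> snd (cl K v) \<and> j \<le> snd (cl K w) \<and>
     (i = 0 \<and> j = 0 \<and> ad K v w \<or> v = w \<and> (i = 0) \<noteq> (j = 0))"
  "cl (tattach K) (prod_encode (v, i)) = (if i = 0 then fst (cl K v) else 0)"
  by (auto simp: tattach_def)

lemma prod_encode_cases: obtains v i where "x = prod_encode (v, i)"
  by (metis prod_decode_inverse surj_pair)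

lemma vs_tattach: "vs (tattach K) = prod_encode ` (SIGMA v:vs K. {..snd (cl K v)})"
  by (simp add: tattach_def)

lemma ad_tattach: "conn_cgraph K \<Longrightarrow> ad (tattach K) x y \<Longrightarrow>
    x \<in> vs (tattach K) \<and> y \<in> vs (tattach K) \<and> x \<noteq> y \<and> ad (tattach K) y x"
  by (cases x rule: prod_encode_cases; cases y rule: prod_encode_cases)
    (auto simp: conn_cgraphD(5) dest: conn_cgraphD(4))

lemma conn_tattach:
  assumes K: "conn_cgraph K" shows "conn_cgraph (tattach K)"
proof (rule conn_via_retract[OF _ _ K, where e = "\<lambda>v. prod_encode (v, 0)" and r = "fst \<circ> prod_decode"])
  show "finite (vs (tattach K))" using conn_cgraphD(1)[OF K] by (simp add: vs_tattach)
  show "x \<in> vs (tattach K) \<and> y \<in> vs (tattach K) \<and> x \<noteq> y \<and> ad (tattach K) y x"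
    if "ad (tattach K) x y" for x y using ad_tattach[OF K that] .
  show "ad (tattach K) (prod_encode (v, 0)) (prod_encode (w, 0))" if "ad K v w" for v w
    using that conn_cgraphD(2,3)[OF K that] by simp
  show "(fst \<circ> prod_decode) x \<in> vs K \<and>
      (x = prod_encode ((fst \<circ> prod_decode) x, 0) \<or>
       ad (tattach K) x (prod_encode ((fst \<circ> prod_decode) x, 0)))" if "x \<in> vs (tattach K)" for x
    using that by (cases x rule: prod_encode_cases) auto
qed

text \<open>The contribution of one core vertex to the content of the rebuilt graph: its own colour
  and its plain leaves.\<close>

definition twt :: "nat \<times> nat \<Rightarrow> nat multiset" where
  "twt d = add_mset (fst d) (replicate_mset (snd d) 0)"

lemma content_tattach:
  assumes "finite (vs K)" shows "content (tattach K) = (\<Sum>d\<in>#content K. twt d)"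
proof -
  have "content (tattach K) = (\<Sum>x\<in>(SIGMA v:vs K. {..snd (cl K v)}). {#cl (tattach K) (prod_encode x)#})"
    unfolding content_sum vs_tattach by (subst sum.reindex) (auto simp: inj_prod_encode comp_def)
  also have "\<dots> = (\<Sum>v\<in>vs K. \<Sum>i\<le>snd (cl K v). {#if i = 0 then fst (cl K v) else 0#})"
    using assms by (subst sum.Sigma) (auto intro!: sum.cong)
  also have "(\<Sum>i\<le>k. {#if i = 0 then c else 0#}) = twt (c, k)" for c k :: nat
    by (induction k) (auto simp: twt_def)
  then have "(\<Sum>v\<in>vs K. \<Sum>i\<le>snd (cl K v). {#if i = 0 then fst (cl K v) else 0#}) = (\<Sum>v\<in>vs K. twt (cl K v))"
    by simp
  finally show ?thesis by (simp add: sum_mset_content)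
qed

definition tgraphs :: "nat cgraph set" where
  "tgraphs = {G. conn_cgraph G \<and> content G \<noteq> {#0, 0#}}"

text \<open>A vertex coloured \<open>(0, 0)\<close> lost no leaf, so if it were a leaf of the core
  it would have been a plain leaf before and hence deleted. The last condition rules out the single
  vertex coloured \<open>(0, 1)\<close>, which would rebuild the excluded graph.\<close>

definition tcores :: "(nat \<times> nat) cgraph set" where
  "tcores = {K. conn_cgraph K \<and> (\<forall>v. \<not> zleaf (0, 0) K v) \<and> (\<Sum>d\<in>#content K. twt d) \<noteq> {#0, 0#}}"

text \<open>Two adjacent leaves form a set closed under adjacency, hence the whole graph, and with
  both plain this is the excluded one. It ensures that a stem survives the deletion of all
  leaves.\<close>

lemma stem_not_zleaf:
  assumes G: "G \<in> tgraphs" and u: "zleaf 0 G u" and "ad G u v"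
  shows "\<not> zleaf 0 G v"
proof
  assume v: "zleaf 0 G v"
  have conn: "conn_cgraph G" using G by (simp add: tgraphs_def)
  have "ad G v u" using assms(3) conn_cgraphD(5)[OF conn] by blast
  then have st: "stem G u = v" "stem G v = u" using assms(3) stem[OF u] stem[OF v] by simp_all
  have "vs G = {u, v}"
    by (rule closed_set_eq_vs[OF conn, of u])
      (use u v stem[OF u] stem[OF v] st in \<open>auto simp: zleaf_def\<close>)
  moreover have "u \<noteq> v" using conn_cgraphD(4)[OF conn] assms by blast
  ultimately have "content G = {#0, 0#}" using u v by (simp add: content_def zleaf_def)
  then show False using G by (simp add: tgraphs_def)
qed

lemma finite_leaves_at: "conn_cgraph G \<Longrightarrow> finite (leaves_at G v)"
  by (rule finite_subset[OF _ conn_cgraphD(1)]) (auto simp: leaves_at_def zleaf_def)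

lemma conn_tcore: assumes "G \<in> tgraphs" shows "conn_cgraph (tcore G)"
proof -
  have conn: "conn_cgraph G" using assms by (simp add: tgraphs_def)
  show ?thesis
  proof (rule conn_induced[OF conn, where r = "\<lambda>x. if zleaf 0 G x then stem G x else x"])
    show "ad (tcore G) x y \<longleftrightarrow> x \<in> vs (tcore G) \<and> y \<in> vs (tcore G) \<and> ad G x y" for x y
      using conn_cgraphD(2,3)[OF conn] by auto
    fix x y assume *: "ad G x y"
    then have **: "ad G y x" using conn_cgraphD(5)[OF conn] by blast
    show "(if zleaf 0 G x then stem G x else x) = (if zleaf 0 G y then stem G y else y) \<or>
       ad (tcore G) (if zleaf 0 G x then stem G x else x) (if zleaf 0 G y then stem G y else y)"
    proof (cases "zleaf 0 G x \<or> zleaf 0 G y")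
      case True
      then show ?thesis
        using stem_not_zleaf[OF assms _ *] stem_not_zleaf[OF assms _ **]
          stem[of 0 G x y] stem[of 0 G y x] * ** by metis
    qed (use * in simp)
  qed auto
qed

lemma tattach_tcore: assumes "G \<in> tgraphs" shows "G \<approx> tattach (tcore G)"
proof -
  have conn: "conn_cgraph G" using assms by (simp add: tgraphs_def)
  note G = conn_cgraphD[OF conn]
  have "\<exists>h. bij_betw h (leaves_at G v) {..<card (leaves_at G v)}" for v
    using finite_same_card_bij[of "leaves_at G v" "{..<card (leaves_at G v)}"]
      finite_leaves_at[OF conn] by simp
  then obtain h where h: "\<And>v. bij_betw (h v) (leaves_at G v) {..<card (leaves_at G v)}" by metis
  \<comment> \<open>The numbering \<open>h\<close> of the leaves at each stem is arbitrary, since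
    such leaves are interchangeable. It is shifted by one because index 0 belongs to the
    stem.\<close>
  define F where "F u = (if zleaf 0 G u then prod_encode (stem G u, Suc (h (stem G u) u))
    else prod_encode (u, 0))" for u
  have lf: "u \<in> leaves_at G (stem G u)" "stem G u \<in> vs G" "\<not> zleaf 0 G (stem G u)"
    if "zleaf 0 G u" for u
  proof -
    have *: "ad G u (stem G u)" using stem[OF that] by simp
    show "u \<in> leaves_at G (stem G u)" using * G(5)[of u] that by (simp add: leaves_at_def)
    show "stem G u \<in> vs G" using G(3)[OF *] .
    show "\<not> zleaf 0 G (stem G u)" using stem_not_zleaf[OF assms that *] .
  qed
  have hl: "h (stem G u) u < card (leaves_at G (stem G u))" if "zleaf 0 G u" for u
    using lf(1)[OF that] h by (auto simp: bij_betw_def)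
  have "inj_on F (vs G)"
  proof (rule inj_onI)
    fix x y assume "x \<in> vs G" "y \<in> vs G" "F x = F y"
    then show "x = y"
      using lf(1)[of x] lf(1)[of y] bij_betw_imp_inj_on[OF h]
      by (auto simp: F_def inj_on_def split: if_splits)
  qed
  moreover have "F ` vs G = vs (tattach (tcore G))"
  proof (intro set_eqI iffI)
    fix x assume "x \<in> F ` vs G"
    then obtain u where "u \<in> vs G" "x = F u" by blast
    then show "x \<in> vs (tattach (tcore G))"
      using lf hl by (auto simp: F_def Suc_le_eq)
  next
    fix x assume x: "x \<in> vs (tattach (tcore G))"
    obtain v i where vi: "x = prod_encode (v, i)" by (rule prod_encode_cases)
    with x have v: "v \<in> vs G" "\<not> zleaf 0 G v" "i \<le> card (leaves_at G v)" by auto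
    show "x \<in> F ` vs G"
    proof (cases i)
      case 0
      then have "F v = x" using v vi by (simp add: F_def)
      then show ?thesis using v by blast
    next
      case (Suc j)
      then have "j \<in> h v ` leaves_at G v" using v h by (auto simp: bij_betw_def)
      then obtain u where u: "u \<in> leaves_at G v" "h v u = j" by blast
      then have "zleaf 0 G u" "ad G v u" by (auto simp: leaves_at_def)
      moreover from this have "stem G u = v" using stem[of 0 G u v] G(5)[of u v] by simp
      ultimately have "F u = x" "u \<in> vs G" using u Suc vi by (auto simp: F_def zleaf_def)
      then show ?thesis by blast
    qed
  qed
  moreover have "ad (tattach (tcore G)) (F x) (F y) \<longleftrightarrow> ad G x y"
    if "x \<in> vs G" "y \<in> vs G" for x y
  proof -
    have sx: "ad G x w \<longleftrightarrow> w = stem G x" "ad G w x \<longleftrightarrow> w = stem G x" if "zleaf 0 G x" for w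
      using stem[OF that] G(5) by blast+
    have sy: "ad G y w \<longleftrightarrow> w = stem G y" "ad G w y \<longleftrightarrow> w = stem G y" if "zleaf 0 G y" for w
      using stem[OF that] G(5) by blast+
    show ?thesis
      using that lf[of x] lf[of y] hl[of x] hl[of y] sx sy
      by (cases "zleaf 0 G x"; cases "zleaf 0 G y") (auto simp: F_def Suc_le_eq)
  qed
  moreover have "cl (tattach (tcore G)) (F x) = cl G x" if "x \<in> vs G" for x
    by (auto simp: F_def zleaf_def)
  ultimately have "iso_map F G (tattach (tcore G))" by (simp add: iso_map_def bij_betw_def)
  then show ?thesis unfolding iso_def by blast
qed

lemma content_tcore: assumes "G \<in> tgraphs" shows "(\<Sum>d\<in>#content (tcore G). twt d) = content G"
  using content_iso[OF tattach_tcore[OF assms]] content_tattach conn_cgraphD(1)[OF conn_tcore[OF assms]]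
  by metis

lemma tcore_in_tcores: assumes "G \<in> tgraphs" shows "tcore G \<in> tcores"
proof -
  have conn: "conn_cgraph G" using assms by (simp add: tgraphs_def)
  have "\<not> zleaf (0, 0) (tcore G) v" for v
  proof
    assume z: "zleaf (0, 0) (tcore G) v"
    then have "leaves_at G v = {}" "v \<in> vs G" "cl G v = 0" and nz: "\<not> zleaf 0 G v"
      using finite_leaves_at[OF conn] by (auto simp: zleaf_def)
    \<comment> \<open>Nothing next to \<open>v\<close> was deleted, so its degree in the core is its
      degree in \<open>G\<close>; a leaf of the core would be a leaf of \<open>G\<close>.\<close>
    then have eq: "ad (tcore G) v = ad G v" by (auto simp: leaves_at_def fun_eq_iff)
    have "\<exists>!w. ad (tcore G) v w" using z by (simp only: zleaf_def)
    then have "\<exists>!w. ad G v w" by (simp only: eq)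
    then have "zleaf 0 G v" using \<open>v \<in> vs G\<close> \<open>cl G v = 0\<close> by (simp add: zleaf_def)
    with nz show False ..
  qed
  then show ?thesis
    using conn_tcore[OF assms] content_tcore[OF assms] assms by (simp add: tcores_def tgraphs_def)
qed

lemma tattach_in_tgraphs: "K \<in> tcores \<Longrightarrow> tattach K \<in> tgraphs"
  by (simp add: tcores_def tgraphs_def conn_tattach content_tattach conn_cgraphD(1))

text \<open>The delicate direction is that an old vertex never becomes a plain leaf. Without
  attached leaves it would be a leaf coloured \<open>(0, 0)\<close> in \<open>K\<close>; with
  attached leaves it would have exactly one and be isolated in \<open>K\<close>. Both are excluded
  by \<open>tcores\<close>.\<close>

lemma zleaf_tattach:
  assumes K: "K \<in> tcores" and v: "v \<in> vs K" "i \<le> snd (cl K v)"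
  shows "zleaf 0 (tattach K) (prod_encode (v, i)) \<longleftrightarrow> i \<noteq> 0"
proof
  assume "i \<noteq> 0"
  then have "ad (tattach K) (prod_encode (v, i)) x \<longleftrightarrow> x = prod_encode (v, 0)" for x
    using v by (cases x rule: prod_encode_cases) auto
  then show "zleaf 0 (tattach K) (prod_encode (v, i))" using v \<open>i \<noteq> 0\<close> by (simp add: zleaf_def)
next
  have conn: "conn_cgraph K" and nz: "\<not> zleaf (0, 0) K v" and
    ct: "(\<Sum>d\<in>#content K. twt d) \<noteq> {#0, 0#}" using K by (simp_all add: tcores_def)
  assume z: "zleaf 0 (tattach K) (prod_encode (v, i))"
  show "i \<noteq> 0"
  proof
    assume [simp]: "i = 0"
    have c: "fst (cl K v) = 0" and
      uq: "\<And>x y. ad (tattach K) (prod_encode (v, 0)) x \<Longrightarrow> ad (tattach K) (prod_encode (v, 0)) y \<Longrightarrow> x = y"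
      and "\<exists>x. ad (tattach K) (prod_encode (v, 0)) x"
      using z by (auto simp: zleaf_def)
    then obtain w j where w: "ad (tattach K) (prod_encode (v, 0)) (prod_encode (w, j))"
      by (metis prod_encode_cases)
    show False
    proof (cases "snd (cl K v)")
      case 0
      then have "ad K v w" using w by auto
      moreover have "u = w" if "ad K v u" for u
        using uq[of "prod_encode (u, 0)" "prod_encode (w, 0)"] that \<open>ad K v w\<close> conn_cgraphD(3)[OF conn] v
        by auto
      ultimately have "zleaf (0, 0) K v" using c 0 v by (auto simp: zleaf_def prod_eq_iff)
      with nz show False ..
    next
      case (Suc k)
      \<comment> \<open>The attached leaf with index 1 is already the unique neighbour, so there is
        no second leaf and no neighbour inside \<open>K\<close>; connectedness leaves only
        \<open>v\<close>.\<close>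
      have one: "ad (tattach K) (prod_encode (v, 0)) (prod_encode (v, 1))" using v Suc by simp
      have "k = 0"
        using uq[OF one, of "prod_encode (v, 2)"] v Suc by (cases k) auto
      moreover have "\<not> ad K v u" for u
        using uq[OF one, of "prod_encode (u, 0)"] v conn_cgraphD(3)[OF conn] by auto
      then have "vs K = {v}" by (intro closed_set_eq_vs[OF conn]) (use v in auto)
      ultimately have "(\<Sum>d\<in>#content K. twt d) = {#0, 0#}"
        using Suc c by (simp add: content_def twt_def)
      with ct show False ..
    qed
  qed
qed

lemma tcore_tattach: assumes K: "K \<in> tcores" shows "tcore (tattach K) \<approx> K"
proof (rule iso_sym)
  let ?e = "\<lambda>v. prod_encode (v, 0)"
  have lv: "leaves_at (tattach K) (?e v) = prod_encode ` ({v} \<times> {1..snd (cl K v)})" if "v \<in> vs K" for v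
  proof (intro set_eqI)
    fix x
    obtain w i where x: "x = prod_encode (w, i)" by (rule prod_encode_cases)
    show "x \<in> leaves_at (tattach K) (?e v) \<longleftrightarrow> x \<in> prod_encode ` ({v} \<times> {1..snd (cl K v)})"
      using zleaf_tattach[OF K, of w i] that
      by (auto simp: x leaves_at_def inj_image_mem_iff[OF inj_prod_encode])
  qed
  have "iso_map ?e K (tcore (tattach K))"
    unfolding iso_map_def
  proof (intro conjI ballI)
    show "bij_betw ?e (vs K) (vs (tcore (tattach K)))"
      unfolding bij_betw_def
    proof
      show "inj_on ?e (vs K)" by (auto simp: inj_on_def)
      show "?e ` vs K = vs (tcore (tattach K))"
      proof (intro set_eqI)
        fix x
        obtain w i where x: "x = prod_encode (w, i)" by (rule prod_encode_cases)
        show "x \<in> ?e ` vs K \<longleftrightarrow> x \<in> vs (tcore (tattach K))"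
          using zleaf_tattach[OF K, of w i] by (auto simp: x)
      qed
    qed
    show "ad (tcore (tattach K)) (?e x) (?e y) \<longleftrightarrow> ad K x y" if "x \<in> vs K" "y \<in> vs K" for x y
      using that zleaf_tattach[OF K] by simp
    show "cl (tcore (tattach K)) (?e x) = cl K x" if "x \<in> vs K" for x
      using that by (simp add: lv card_image[OF inj_prod_encode] card_cartesian_product_singleton)
  qed
  then show "K \<approx> tcore (tattach K)" unfolding iso_def by blast
qed

lemma tattach_iso: assumes "K \<approx> L" shows "tattach K \<approx> tattach L"
proof -
  from assms obtain g where "iso_map g K L" unfolding iso_def by blast
  note g = iso_mapD[OF this]
  let ?F = "\<lambda>x. case prod_decode x of (v, i) \<Rightarrow> prod_encode (g v, i)"
  have "bij_betw ?F (vs (tattach K)) (vs (tattach L))"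
    unfolding bij_betw_def
  proof
    show "inj_on ?F (vs (tattach K))"
    proof (rule inj_onI)
      fix x y assume "x \<in> vs (tattach K)" "y \<in> vs (tattach K)" "?F x = ?F y"
      then show "x = y"
        by (cases x rule: prod_encode_cases; cases y rule: prod_encode_cases) (auto simp: g(5))
    qed
    show "?F ` vs (tattach K) = vs (tattach L)"
    proof (intro set_eqI iffI)
      fix x assume "x \<in> ?F ` vs (tattach K)"
      then obtain y where "x = ?F y" "y \<in> vs (tattach K)" by blast
      then show "x \<in> vs (tattach L)"
        by (cases y rule: prod_encode_cases) (auto simp: g(4,7))
    next
      fix x assume x: "x \<in> vs (tattach L)"
      obtain w i where wi: "x = prod_encode (w, i)" by (rule prod_encode_cases)
      then obtain v where "w = g v" "v \<in> vs K" using x g(3) by auto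
      then have "x = ?F (prod_encode (v, i))" "prod_encode (v, i) \<in> vs (tattach K)"
        using x wi g(7) by auto
      then show "x \<in> ?F ` vs (tattach K)" by blast
    qed
  qed
  moreover have "ad (tattach L) (?F x) (?F y) \<longleftrightarrow> ad (tattach K) x y"
    if "x \<in> vs (tattach K)" "y \<in> vs (tattach K)" for x y
    using that
    by (cases x rule: prod_encode_cases; cases y rule: prod_encode_cases) (auto simp: g(4,5,6,7))
  moreover have "cl (tattach L) (?F x) = cl (tattach K) x" if "x \<in> vs (tattach K)" for x
    using that by (cases x rule: prod_encode_cases) (auto simp: g(7))
  ultimately have "iso_map ?F (tattach K) (tattach L)" by (simp add: iso_map_def)
  then show ?thesis unfolding iso_def by blast
qed

lemma tcore_iso:
  assumes "G \<in> tgraphs" "H \<in> tgraphs" "G \<approx> H" shows "tcore G \<approx> tcore H"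
proof -
  from assms obtain f where f: "iso_map f G H" unfolding iso_def by blast
  have c: "conn_cgraph G" "conn_cgraph H" using assms by (simp_all add: tgraphs_def)
  note zl = zleaf_iso_map[OF f c] and tf = tuft_set_iso_map[OF f c]
  note fD = iso_mapD[OF f]
  have "bij_betw f (vs (tcore G)) (vs (tcore H))"
    unfolding bij_betw_def
  proof
    show "inj_on f (vs (tcore G))" using fD(2) by (rule inj_on_subset) auto
    show "f ` vs (tcore G) = vs (tcore H)" using zl by (auto simp: fD(3)[symmetric])
  qed
  then have "iso_map f (tcore G) (tcore H)"
    using fD(6,7) zl tf by (auto simp: iso_map_def leaves_at_def)
  then show ?thesis unfolding iso_def by blast
qed

section \<open>Decoding a colour into plain vertices, and the tuft step\<close>

lemma replicate_mset_plus: "replicate_mset (m + k) c = replicate_mset m c + replicate_mset k c"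
  by (rule multiset_eqI) simp

definition unfold_col :: "nat \<Rightarrow> nat \<Rightarrow> nat multiset \<Rightarrow> nat multiset" where
  "unfold_col \<alpha> k M = (\<Sum>c\<in>#M. if c = \<alpha> then replicate_mset k 0 else {#c#})"

lemma unfold_col_simps [simp]:
  "unfold_col \<alpha> k {#} = {#}"
  "unfold_col \<alpha> k (add_mset c M) = (if c = \<alpha> then replicate_mset k 0 else {#c#}) + unfold_col \<alpha> k M"
  "unfold_col \<alpha> k (M + N) = unfold_col \<alpha> k M + unfold_col \<alpha> k N"
  by (simp_all add: unfold_col_def)

lemma unfold_col_sum: "unfold_col \<alpha> k (\<Sum>d\<in>#D. w d) = (\<Sum>d\<in>#D. unfold_col \<alpha> k (w d))"
  by (induction D) auto

lemma unfold_col_fresh: "\<alpha> \<notin># M \<Longrightarrow> unfold_col \<alpha> k M = M"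
  by (induction M) auto

lemma unfold_col_replicate [simp]:
  "unfold_col \<alpha> k (replicate_mset m c) = (if c = \<alpha> then replicate_mset (m * k) 0 else replicate_mset m c)"
  by (induction m) (auto simp: replicate_mset_plus add.commute)

text \<open>Leaf-free cores turn the claim into a bijection on pairs of colour and leaf number. The
  decoded weight \<open>b + 2\<close> counts the stem and the \<open>b + 1\<close> leaves taken away
  from it.\<close>

lemma card_types_tuft_step:
  assumes \<alpha>: "\<alpha> \<noteq> 0" "\<alpha> \<notin># M" and M: "M \<noteq> {#0, 0#}"
  shows "card (types {G. conn_cgraph G \<and> content G = M}) =
    card (types {G. conn_cgraph G \<and> tuft_bounded 0 b G \<and> unfold_col \<alpha> (Suc (Suc b)) (content G) = M})"
proof -
  \<comment> \<open>One reduction per vertex suffices: a stem that has received \<alpha> is no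
    longer plain, so its remaining leaf number is subject to no bound, and every such number
    arises.\<close>
  define \<theta> where "\<theta> d = (if fst d = 0 \<and> snd d > b then (\<alpha>, snd d - Suc b) else d)" for d :: "nat \<times> nat"
  define \<theta>' where "\<theta>' d = (if fst d = \<alpha> then (0, snd d + Suc b) else d)" for d :: "nat \<times> nat"
  define A where "A = {K. (\<Sum>d\<in>#content K. twt d) = M}"
  define B where "B = {K. (\<forall>d\<in>#content K. fst d = 0 \<longrightarrow> snd d \<le> b) \<and>
     unfold_col \<alpha> (Suc (Suc b)) (\<Sum>d\<in>#content K. twt d) = M}"
  \<comment> \<open>The excluded content contains no \<alpha>, hence decodes to itself; as it
    differs from \<open>M\<close>, it is absent on the encoded side too.\<close>
  have two: "unfold_col \<alpha> (Suc (Suc b)) N \<noteq> M" if "N = {#0, 0#}" for N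
    using that M \<alpha> by simp
  have wt': "unfold_col \<alpha> (Suc (Suc b)) (twt d) = twt (\<theta>' d)" for d
    using \<alpha> by (cases d) (auto simp: \<theta>'_def twt_def replicate_mset_plus)
  have no_\<alpha>: "fst d \<noteq> \<alpha>" if "K \<in> A" "d \<in># content K" for K d
  proof
    assume "fst d = \<alpha>"
    then have "\<alpha> \<in># (\<Sum>d\<in>#content K. twt d)" using that(2) by (auto simp: twt_def intro!: bexI[of _ d])
    moreover have "(\<Sum>d\<in>#content K. twt d) = M" using that(1) by (simp add: A_def)
    ultimately show False using \<alpha>(2) by simp
  qed
  have \<theta>'\<theta>: "\<theta>' (\<theta> d) = d" if "fst d \<noteq> \<alpha>" for d
    using that by (cases d) (auto simp: \<theta>_def \<theta>'_def)
  have \<theta>\<theta>': "\<theta> (\<theta>' d) = d" if "fst d = 0 \<longrightarrow> snd d \<le> b" for d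
    using that by (cases d) (auto simp: \<theta>_def \<theta>'_def)
  have cont: "cl K v \<in># content K" if "K \<in> tcores" "v \<in> vs K" for K v
    using that conn_cgraphD(1) in_content by (fastforce simp: tcores_def)
  have "card (types {G \<in> tgraphs. tcore G \<in> A}) = card (types {G \<in> tgraphs. tcore G \<in> B})"
  proof (rule card_types_eq_via_core[where \<K> = tcores and build = tattach and \<theta> = \<theta> and \<theta>' = \<theta>'])
    show "tattach (tcore G) \<approx> G" if "G \<in> tgraphs" for G using tattach_tcore[OF that] iso_sym by blast
    show "L \<in> A" if "K \<approx> L" "K \<in> A" for K L using that content_iso[of K L] by (simp add: A_def)
    show "L \<in> B" if "K \<approx> L" "K \<in> B" for K L using that content_iso[of K L] by (simp add: B_def)
    fix K assume K: "K \<in> tcores"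
    note KD = K[unfolded tcores_def, simplified]
    show "recolor \<theta> K \<in> tcores \<inter> B" if "K \<in> A"
    proof -
      have "unfold_col \<alpha> (Suc (Suc b)) (\<Sum>d\<in>#content (recolor \<theta> K). twt d) = (\<Sum>d\<in>#content K. twt (\<theta>' (\<theta> d)))"
        by (simp add: unfold_col_sum wt' multiset.map_comp comp_def)
      also have "\<dots> = (\<Sum>d\<in>#content K. twt d)"
        using no_\<alpha>[OF that] \<theta>'\<theta> by (intro arg_cong[where f = sum_mset] image_mset_cong) simp
      finally have un: "unfold_col \<alpha> (Suc (Suc b)) (\<Sum>d\<in>#content (recolor \<theta> K). twt d) = M"
        using that by (simp add: A_def)
      moreover have "\<not> zleaf (0, 0) (recolor \<theta> K) v" for v
      proof -
        \<comment> \<open>No new colour \<open>(0, 0)\<close> is created, since an altered colour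
          has first component \<alpha>. Thus the recoloured graph is again a legitimate
          core.\<close>
        have "\<theta> d = (0, 0) \<Longrightarrow> d = (0, 0)" for d using \<alpha> by (auto simp: \<theta>_def split: if_splits)
        then show ?thesis using KD by (auto simp: zleaf_def)
      qed
      moreover have "fst (\<theta> d) = 0 \<longrightarrow> snd (\<theta> d) \<le> b" for d using \<alpha> by (auto simp: \<theta>_def)
      ultimately show ?thesis using KD two[of "\<Sum>d\<in>#content (recolor \<theta> K). twt d"]
        by (auto simp: tcores_def B_def)
    qed
    show "recolor \<theta>' K \<in> tcores \<inter> A" if "K \<in> B"
    proof -
      have "(\<Sum>d\<in>#content (recolor \<theta>' K). twt d) = unfold_col \<alpha> (Suc (Suc b)) (\<Sum>d\<in>#content K. twt d)"
        by (simp add: unfold_col_sum wt' multiset.map_comp comp_def)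
      then have "(\<Sum>d\<in>#content (recolor \<theta>' K). twt d) = M" using that by (simp add: B_def)
      moreover have "\<not> zleaf (0, 0) (recolor \<theta>' K) v" for v
      proof -
        have "\<theta>' d = (0, 0) \<Longrightarrow> d = (0, 0)" for d by (auto simp: \<theta>'_def split: if_splits)
        then show ?thesis using KD by (auto simp: zleaf_def)
      qed
      ultimately show ?thesis using KD M by (auto simp: tcores_def A_def)
    qed
    show "\<theta>' (\<theta> (cl K v)) = cl K v" if "K \<in> A" "v \<in> vs K" for v
      using \<theta>'\<theta> no_\<alpha> cont K that by blast
    show "\<theta> (\<theta>' (cl K v)) = cl K v" if "K \<in> B" "v \<in> vs K" for v
      using \<theta>\<theta>' cont[OF K that(2)] that by (simp add: B_def)
  qed (auto intro: tcore_in_tcores tcore_iso tattach_in_tgraphs tattach_iso tcore_tattach)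
  moreover have "{G \<in> tgraphs. tcore G \<in> A} = {G. conn_cgraph G \<and> content G = M}"
    using content_tcore M by (auto simp: A_def tgraphs_def)
  moreover have "{G \<in> tgraphs. tcore G \<in> B} =
     {G. conn_cgraph G \<and> tuft_bounded 0 b G \<and> unfold_col \<alpha> (Suc (Suc b)) (content G) = M}"
  proof -
    have "(\<forall>d\<in>#content (tcore G). fst d = 0 \<longrightarrow> snd d \<le> b) \<longleftrightarrow> tuft_bounded 0 b G" if "G \<in> tgraphs" for G
    proof -
      have conn: "conn_cgraph G" using that by (simp add: tgraphs_def)
      \<comment> \<open>The tuft bound speaks of all plain vertices, the core only of those that are
        not plain leaves. The missing ones satisfy the bound because leaves carry no leaves.\<close>
      have "leaves_at G v = {}" if "zleaf 0 G v" for v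
        using stem_not_zleaf[OF \<open>G \<in> tgraphs\<close> that] by (auto simp: leaves_at_def)
      then have "card (leaves_at G v) \<le> b" if "zleaf 0 G v" for v using that by simp
      then show ?thesis
        using conn_cgraphD(1)[OF conn] by (auto simp: content_def tuft_bounded_def leaves_at_def)
    qed
    moreover have "G \<in> tgraphs" if "conn_cgraph G" "unfold_col \<alpha> (Suc (Suc b)) (content G) = M" for G
      using that two by (auto simp: tgraphs_def)
    ultimately show ?thesis using content_tcore by (auto simp: B_def tgraphs_def)
  qed
  ultimately show ?thesis by simp
qed

section \<open>Merging closed twins\<close>

lemma mem_cnb: "u \<in> cnb G v \<longleftrightarrow> u = v \<or> ad G u v"
  by (simp add: cnb_def)

text \<open>The fresh colour \<beta> takes part on the same terms as 0, so that a class remains one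
  class after some of its members have been encoded. Vertices of all other colours are kept apart
  even when their closed neighbourhoods agree.\<close>

definition twins :: "nat \<Rightarrow> nat cgraph \<Rightarrow> nat \<Rightarrow> nat \<Rightarrow> bool" where
  "twins \<beta> G u v \<longleftrightarrow> u = v \<or> cl G u \<in> {0, \<beta>} \<and> cl G v \<in> {0, \<beta>} \<and> cnb G u = cnb G v"

definition rep :: "nat \<Rightarrow> nat cgraph \<Rightarrow> nat \<Rightarrow> nat" where
  "rep \<beta> G v = (LEAST u. u \<in> vs G \<and> twins \<beta> G u v)"

definition twin_class :: "nat \<Rightarrow> nat cgraph \<Rightarrow> nat \<Rightarrow> nat set" where
  "twin_class \<beta> G x = {u \<in> vs G. rep \<beta> G u = x}"

text \<open>The sibling analogue of \<open>tcore\<close>: the quotient by twins, realised on least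
  representatives, with the multiset of colours of a class as new colour.\<close>

definition score :: "nat \<Rightarrow> nat cgraph \<Rightarrow> nat multiset cgraph" where
  "score \<beta> G = \<lparr>vs = rep \<beta> G ` vs G,
     ad = (\<lambda>x y. ad G x y \<and> x \<in> rep \<beta> G ` vs G \<and> y \<in> rep \<beta> G ` vs G),
     cl = (\<lambda>x. image_mset (cl G) (mset_set (twin_class \<beta> G x)))\<rparr>"

lemma score_simps [simp]:
  "vs (score \<beta> G) = rep \<beta> G ` vs G"
  "ad (score \<beta> G) x y \<longleftrightarrow> ad G x y \<and> x \<in> rep \<beta> G ` vs G \<and> y \<in> rep \<beta> G ` vs G"
  "cl (score \<beta> G) x = image_mset (cl G) (mset_set (twin_class \<beta> G x))"
  by (simp_all add: score_def)

lemma twins_sym: "twins \<beta> G u v \<Longrightarrow> twins \<beta> G v u" by (auto simp: twins_def)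
lemma twins_trans: "twins \<beta> G u v \<Longrightarrow> twins \<beta> G v w \<Longrightarrow> twins \<beta> G u w" by (auto simp: twins_def)

lemma rep_in: assumes "v \<in> vs G" shows "rep \<beta> G v \<in> vs G" "twins \<beta> G (rep \<beta> G v) v"
proof -
  have "v \<in> vs G \<and> twins \<beta> G v v" using assms by (simp add: twins_def)
  then have "rep \<beta> G v \<in> vs G \<and> twins \<beta> G (rep \<beta> G v) v" unfolding rep_def by (rule LeastI)
  then show "rep \<beta> G v \<in> vs G" "twins \<beta> G (rep \<beta> G v) v" by auto
qed

lemma rep_eq_iff:
  assumes "u \<in> vs G" "v \<in> vs G" shows "rep \<beta> G u = rep \<beta> G v \<longleftrightarrow> twins \<beta> G u v"
proof
  assume "rep \<beta> G u = rep \<beta> G v"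
  then show "twins \<beta> G u v" using rep_in(2)[OF assms(1)] rep_in(2)[OF assms(2)] twins_sym twins_trans by metis
next
  assume "twins \<beta> G u v"
  then have "twins \<beta> G w u \<longleftrightarrow> twins \<beta> G w v" for w using twins_sym twins_trans by metis
  then show "rep \<beta> G u = rep \<beta> G v" by (simp add: rep_def)
qed

lemma rep_rep [simp]: "v \<in> vs G \<Longrightarrow> rep \<beta> G (rep \<beta> G v) = rep \<beta> G v"
  using rep_eq_iff rep_in by blast

lemma twins_ad:
  assumes "conn_cgraph G" "twins \<beta> G u v" "u \<noteq> v" shows "ad G u v"
  using assms mem_cnb[of u G u] mem_cnb[of u G v] by (auto simp: twins_def)

lemma twins_ad_cong:
  assumes "conn_cgraph G" "twins \<beta> G u u'" "v \<noteq> u" "v \<noteq> u'" shows "ad G v u \<longleftrightarrow> ad G v u'"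
  using assms mem_cnb[of v G u] mem_cnb[of v G u'] by (auto simp: twins_def)

text \<open>The two endpoints are exchanged for their representatives one at a time; lying in
  different classes guarantees that the vertices compared at each exchange are distinct.\<close>

lemma ad_rep:
  assumes "conn_cgraph G" "u \<in> vs G" "v \<in> vs G" "rep \<beta> G u \<noteq> rep \<beta> G v"
  shows "ad G (rep \<beta> G u) (rep \<beta> G v) \<longleftrightarrow> ad G u v"
proof -
  have "rep \<beta> G u \<noteq> v" "u \<noteq> v" using assms rep_rep by metis+
  have "ad G (rep \<beta> G u) (rep \<beta> G v) \<longleftrightarrow> ad G (rep \<beta> G u) v"
    using twins_ad_cong[OF assms(1) rep_in(2)[OF assms(3)]] assms \<open>rep \<beta> G u \<noteq> v\<close> by metis
  also have "\<dots> \<longleftrightarrow> ad G v (rep \<beta> G u)" using conn_cgraphD(5)[OF assms(1)] .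
  also have "\<dots> \<longleftrightarrow> ad G v u"
    using twins_ad_cong[OF assms(1) rep_in(2)[OF assms(2)]] \<open>u \<noteq> v\<close> \<open>rep \<beta> G u \<noteq> v\<close> by metis
  finally show ?thesis using conn_cgraphD(5)[OF assms(1)] by blast
qed

text \<open>Twin classes are cliques, and adjacency between different classes does not depend on the
  members, so closed neighbourhoods pass to the quotient and can be recovered from it.\<close>

lemma rep_mem_cnb_score:
  assumes "conn_cgraph G" "u \<in> vs G" "v \<in> vs G"
  shows "rep \<beta> G u \<in> cnb (score \<beta> G) (rep \<beta> G v) \<longleftrightarrow> u \<in> cnb G v"
proof (cases "rep \<beta> G u = rep \<beta> G v")
  case True
  then have "twins \<beta> G u v" using rep_eq_iff assms by blast
  then show ?thesis using twins_ad[OF assms(1)] True by (auto simp: mem_cnb)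
next
  case False
  then show ?thesis using ad_rep[OF assms False] assms by (auto simp: mem_cnb)
qed

lemma conn_score: assumes G: "conn_cgraph G" shows "conn_cgraph (score \<beta> G)"
proof (rule conn_induced[OF G, where r = "rep \<beta> G"])
  show "vs (score \<beta> G) \<subseteq> vs G" using rep_in(1) by auto
  show "ad (score \<beta> G) x y \<longleftrightarrow> x \<in> vs (score \<beta> G) \<and> y \<in> vs (score \<beta> G) \<and> ad G x y" for x y by auto
  show "rep \<beta> G x = x" if "x \<in> vs (score \<beta> G)" for x using that by auto
  show "rep \<beta> G x = rep \<beta> G y \<or> ad (score \<beta> G) (rep \<beta> G x) (rep \<beta> G y)" if "ad G x y" for x y
    using ad_rep[OF G conn_cgraphD(2,3)[OF G that], of \<beta>] conn_cgraphD(2,3)[OF G that] that by auto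
qed

section \<open>Multiplicities in classes and the blow-up of a quotient\<close>

lemma count_image_mset_set:
  "finite S \<Longrightarrow> count (image_mset f (mset_set S)) c = card {x \<in> S. f x = c}"
proof (induction S rule: finite_induct)
  case (insert x S)
  have "{y \<in> insert x S. f y = c} = (if f x = c then insert x {y \<in> S. f y = c} else {y \<in> S. f y = c})"
    by auto
  then show ?case using insert by simp
qed simp

lemma finite_twin_class: "conn_cgraph G \<Longrightarrow> finite (twin_class \<beta> G x)"
  by (simp add: twin_class_def conn_cgraphD(1))

lemma count_cl_score:
  assumes "conn_cgraph G"
  shows "count (cl (score \<beta> G) x) c = card {u \<in> vs G. rep \<beta> G u = x \<and> cl G u = c}"
  using count_image_mset_set[OF finite_twin_class[OF assms], of "cl G" \<beta> x c]
  by (simp add: twin_class_def conj_assoc)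

text \<open>Inverse to the quotient: \<open>v\<close> is replaced by a clique with one vertex for
  each element of its colour multiset. Equal elements are told apart by the index \<open>i\<close>,
  which runs below the multiplicity.\<close>

definition blow :: "nat multiset cgraph \<Rightarrow> nat cgraph" where
  "blow K = \<lparr>vs = (\<lambda>(v, c, i). prod_encode (v, prod_encode (c, i))) `
        (SIGMA v:vs K. SIGMA c:set_mset (cl K v). {..<count (cl K v) c}),
     ad = (\<lambda>x y. case (prod_decode x, prod_decode y) of ((v, p), (w, q)) \<Rightarrow>
        v \<in> vs K \<and> w \<in> vs K \<and>
        snd (prod_decode p) < count (cl K v) (fst (prod_decode p)) \<and>
        snd (prod_decode q) < count (cl K w) (fst (prod_decode q)) \<and>
        (v \<noteq> w \<and> ad K v w \<or> v = w \<and> p \<noteq> q)),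
     cl = (\<lambda>x. fst (prod_decode (snd (prod_decode x))))\<rparr>"

abbreviation enc3 :: "nat \<Rightarrow> nat \<Rightarrow> nat \<Rightarrow> nat" where
  "enc3 v c i \<equiv> prod_encode (v, prod_encode (c, i))"

lemma enc3_cases: obtains v c i where "x = enc3 v c i"
  by (metis prod_decode_inverse surj_pair)

lemma blow_simps [simp]:
  "enc3 v c i \<in> vs (blow K) \<longleftrightarrow> v \<in> vs K \<and> i < count (cl K v) c"
  "ad (blow K) (enc3 v c i) (enc3 w d j) \<longleftrightarrow>
     v \<in> vs K \<and> w \<in> vs K \<and> i < count (cl K v) c \<and> j < count (cl K w) d \<and>
     (v \<noteq> w \<and> ad K v w \<or> v = w \<and> (c, i) \<noteq> (d, j))"
  "cl (blow K) (enc3 v c i) = c"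
proof -
  have *: "i < count (cl K v) c \<Longrightarrow> c \<in># cl K v" by (metis count_inI less_nat_zero_code)
  show "enc3 v c i \<in> vs (blow K) \<longleftrightarrow> v \<in> vs K \<and> i < count (cl K v) c"
    using * by (auto simp: blow_def image_iff)
qed (auto simp: blow_def)

lemma vs_blow: "vs (blow K) = (\<lambda>(v, c, i). enc3 v c i) `
    (SIGMA v:vs K. SIGMA c:set_mset (cl K v). {..<count (cl K v) c})"
  by (simp add: blow_def)

lemma ad_blow: "conn_cgraph K \<Longrightarrow> ad (blow K) x y \<Longrightarrow>
    x \<in> vs (blow K) \<and> y \<in> vs (blow K) \<and> x \<noteq> y \<and> ad (blow K) y x"
  by (cases x rule: enc3_cases; cases y rule: enc3_cases) (auto simp: conn_cgraphD(5))

text \<open>These are the quotients that occur: colours outside 0 and \<beta> come only as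
  singletons because such vertices have no proper twins, and the separation condition says that no
  two classes could still be merged.\<close>

definition scores :: "nat \<Rightarrow> nat multiset cgraph set" where
  "scores \<beta> = {K. conn_cgraph K \<and>
     (\<forall>v\<in>vs K. cl K v \<noteq> {#} \<and> (set_mset (cl K v) \<subseteq> {0, \<beta>} \<or> (\<exists>c. c \<notin> {0, \<beta>} \<and> cl K v = {#c#}))) \<and>
     (\<forall>v\<in>vs K. \<forall>w\<in>vs K. set_mset (cl K v) \<subseteq> {0, \<beta>} \<longrightarrow> set_mset (cl K w) \<subseteq> {0, \<beta>} \<longrightarrow>
        cnb K v = cnb K w \<longrightarrow> v = w)}"

lemma scoresD:
  assumes "K \<in> scores \<beta>"
  shows "conn_cgraph K" "v \<in> vs K \<Longrightarrow> cl K v \<noteq> {#}"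
    "v \<in> vs K \<Longrightarrow> set_mset (cl K v) \<subseteq> {0, \<beta>} \<or> (\<exists>c. c \<notin> {0, \<beta>} \<and> cl K v = {#c#})"
    "v \<in> vs K \<Longrightarrow> w \<in> vs K \<Longrightarrow> set_mset (cl K v) \<subseteq> {0, \<beta>} \<Longrightarrow> set_mset (cl K w) \<subseteq> {0, \<beta>} \<Longrightarrow>
        cnb K v = cnb K w \<Longrightarrow> v = w"
  using assms unfolding scores_def by blast+

lemma conn_blow:
  assumes "K \<in> scores \<beta>" shows "conn_cgraph (blow K)"
proof -
  note K = scoresD[OF assms]
  have "\<exists>c. c \<in># cl K v" if "v \<in> vs K" for v using K(2)[OF that] by (meson multiset_nonemptyE)
  \<comment> \<open>One colour is chosen in each nonempty multiset, so that
    \<open>enc3 v (c v) 0\<close> is a vertex in the clique over \<open>v\<close>; these vertices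
    form a copy of \<open>K\<close>.\<close>
  then obtain c where c: "\<And>v. v \<in> vs K \<Longrightarrow> c v \<in># cl K v" by metis
  then have c0: "0 < count (cl K v) (c v)" if "v \<in> vs K" for v using that by simp
  show ?thesis
  proof (rule conn_via_retract[OF _ _ K(1), where e = "\<lambda>v. enc3 v (c v) 0" and r = "fst \<circ> prod_decode"])
    show "finite (vs (blow K))" using conn_cgraphD(1)[OF K(1)] by (simp add: vs_blow)
    show "x \<in> vs (blow K) \<and> y \<in> vs (blow K) \<and> x \<noteq> y \<and> ad (blow K) y x" if "ad (blow K) x y" for x y
      using ad_blow[OF K(1) that] .
    show "ad (blow K) (enc3 v (c v) 0) (enc3 w (c w) 0)" if "ad K v w" for v w
      using that conn_cgraphD(2,3,4)[OF K(1) that] c0 by simp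
    show "(fst \<circ> prod_decode) x \<in> vs K \<and> (x = enc3 ((fst \<circ> prod_decode) x) (c ((fst \<circ> prod_decode) x)) 0 \<or>
       ad (blow K) x (enc3 ((fst \<circ> prod_decode) x) (c ((fst \<circ> prod_decode) x)) 0))"
      if "x \<in> vs (blow K)" for x
      using that c0 by (cases x rule: enc3_cases) auto
  qed
qed

lemma content_blow:
  assumes "finite (vs K)" shows "content (blow K) = \<Sum>\<^sub># (content K)"
proof -
  have inj: "inj_on (\<lambda>(v, c, i). enc3 v c i) S" for S by (auto simp: inj_on_def)
  have "content (blow K) = (\<Sum>(v, c, i)\<in>(SIGMA v:vs K. SIGMA c:set_mset (cl K v). {..<count (cl K v) c}). {#c#})"
    unfolding content_sum vs_blow by (subst sum.reindex[OF inj]) (auto intro!: sum.cong)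
  also have "\<dots> = (\<Sum>v\<in>vs K. \<Sum>(c, i)\<in>(SIGMA c:set_mset (cl K v). {..<count (cl K v) c}). {#c#})"
    using assms by (subst sum.Sigma) (auto intro!: sum.cong)
  also have "\<dots> = (\<Sum>v\<in>vs K. cl K v)"
  proof (rule sum.cong[OF refl])
    fix v
    have "(\<Sum>(c, i)\<in>(SIGMA c:set_mset (cl K v). {..<count (cl K v) c}). {#c#}) =
        (\<Sum>c\<in>set_mset (cl K v). \<Sum>i<count (cl K v) c. {#c#})"
      by (subst sum.Sigma) auto
    also have "\<dots> = (\<Sum>c\<in>set_mset (cl K v). replicate_mset (count (cl K v) c) c)"
    proof (rule sum.cong[OF refl])
      show "(\<Sum>i<m. {#c#}) = replicate_mset m c" for m and c :: nat by (induction m) auto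
    qed
    also have "\<dots> = cl K v"
      by (rule multiset_eqI) (simp add: count_sum count_eq_zero_iff)
    finally show "(\<Sum>(c, i)\<in>(SIGMA c:set_mset (cl K v). {..<count (cl K v) c}). {#c#}) = cl K v" .
  qed
  finally show ?thesis using sum_mset_content[of "\<lambda>d. d" K] by simp
qed

text \<open>Separation holds because equal closed neighbourhoods in the quotient lift to equal ones
  in \<open>G\<close>; the representatives would then be twins, hence equal.\<close>

lemma score_in_scores: assumes G: "conn_cgraph G" shows "score \<beta> G \<in> scores \<beta>"
proof -
  note fin = finite_twin_class[OF G]
  have self: "x \<in> twin_class \<beta> G x" if "x \<in> rep \<beta> G ` vs G" for x
    using that rep_in(1) by (auto simp: twin_class_def)
  have cls: "twins \<beta> G u x" if "x \<in> rep \<beta> G ` vs G" "u \<in> twin_class \<beta> G x" for x u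
    using that rep_in(2)[of u G \<beta>] twins_sym by (auto simp: twin_class_def)
  have Z: "set_mset (cl (score \<beta> G) x) \<subseteq> {0, \<beta>} \<longleftrightarrow> cl G x \<in> {0, \<beta>}" if "x \<in> rep \<beta> G ` vs G" for x
  proof -
    have sm: "set_mset (cl (score \<beta> G) x) = cl G ` twin_class \<beta> G x" using fin by simp
    have "cl G u \<in> {0, \<beta>}" if "cl G x \<in> {0, \<beta>}" "u \<in> twin_class \<beta> G x" for u
      using cls[OF \<open>x \<in> rep \<beta> G ` vs G\<close> that(2)] that(1) unfolding twins_def by metis
    then show ?thesis using self[OF that] unfolding sm image_subset_iff by metis
  qed
  have "score \<beta> G \<in> {K. (\<forall>v\<in>vs K. \<forall>w\<in>vs K. set_mset (cl K v) \<subseteq> {0, \<beta>} \<longrightarrow>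
      set_mset (cl K w) \<subseteq> {0, \<beta>} \<longrightarrow> cnb K v = cnb K w \<longrightarrow> v = w)}"
  proof (intro CollectI ballI impI)
    fix x y assume xy: "x \<in> vs (score \<beta> G)" "y \<in> vs (score \<beta> G)"
      and z: "set_mset (cl (score \<beta> G) x) \<subseteq> {0, \<beta>}" "set_mset (cl (score \<beta> G) y) \<subseteq> {0, \<beta>}"
      and eq: "cnb (score \<beta> G) x = cnb (score \<beta> G) y"
    have r: "rep \<beta> G x = x" "rep \<beta> G y = y" and xy': "x \<in> vs G" "y \<in> vs G" using xy rep_in(1) by auto
    have "u \<in> cnb G x \<longleftrightarrow> u \<in> cnb G y" if "u \<in> vs G" for u
      using rep_mem_cnb_score[OF G that xy'(1), of \<beta>] rep_mem_cnb_score[OF G that xy'(2), of \<beta>] eq r by simp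
    then have "cnb G x = cnb G y" using cnb_subset[OF G] xy' by blast
    then have "twins \<beta> G x y" using z Z xy by (simp add: twins_def)
    then show "x = y" using rep_eq_iff[OF xy', of \<beta>] r by simp
  qed
  moreover have "cl (score \<beta> G) x \<noteq> {#} \<and> (set_mset (cl (score \<beta> G) x) \<subseteq> {0, \<beta>} \<or>
      (\<exists>c. c \<notin> {0, \<beta>} \<and> cl (score \<beta> G) x = {#c#}))" if x: "x \<in> vs (score \<beta> G)" for x
  proof (cases "cl G x \<in> {0, \<beta>}")
    case True
    then have "set_mset (cl (score \<beta> G) x) \<subseteq> {0, \<beta>}" using Z x by simp
    moreover have "cl (score \<beta> G) x \<noteq> {#}" using self[of x] x fin[of \<beta> x] by (auto simp: mset_set_empty_iff)
    ultimately show ?thesis by blast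
  next
    case False
    then have "twin_class \<beta> G x = {x}" using self[of x] cls[of x] x by (auto simp: twins_def)
    then have "cl (score \<beta> G) x = {#cl G x#}" by simp
    then show ?thesis using False by (metis add_mset_not_empty)
  qed
  ultimately show ?thesis using conn_score[OF G] unfolding scores_def by blast
qed

lemma blow_score: assumes G: "conn_cgraph G" shows "G \<approx> blow (score \<beta> G)"
proof -
  let ?K = "score \<beta> G" and ?r = "rep \<beta> G"
  define S where "S x c = {u \<in> vs G. ?r u = x \<and> cl G u = c}" for x c
  have "\<exists>h. bij_betw h (S x c) {..<count (cl ?K x) c}" for x c
    unfolding count_cl_score[OF G] S_def
    using finite_same_card_bij[of "{u \<in> vs G. ?r u = x \<and> cl G u = c}"
        "{..<card {u \<in> vs G. ?r u = x \<and> cl G u = c}}"] conn_cgraphD(1)[OF G] by simp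
  then obtain h where h: "\<And>x c. bij_betw (h x c) (S x c) {..<count (cl ?K x) c}" by metis
  \<comment> \<open>Within a class, vertices of the same colour are numbered arbitrarily; they have
    equal closed neighbourhoods, so any numbering respects adjacency.\<close>
  define F where "F u = enc3 (?r u) (cl G u) (h (?r u) (cl G u) u)" for u
  have S: "u \<in> S (?r u) (cl G u)" if "u \<in> vs G" for u using that by (simp add: S_def)
  have hl: "h (?r u) (cl G u) u < count (cl ?K (?r u)) (cl G u)" if "u \<in> vs G" for u
    using S[OF that] h[of "?r u" "cl G u"] by (auto simp: bij_betw_def)
  have inj: "inj_on F (vs G)"
  proof (rule inj_onI)
    fix x y assume xy: "x \<in> vs G" "y \<in> vs G" "F x = F y"
    have *: "?r x = ?r y \<and> cl G x = cl G y \<and> h (?r x) (cl G x) x = h (?r y) (cl G y) y"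
      using xy(3) unfolding F_def prod_encode_eq prod.inject .
    then show "x = y"
      using S[OF xy(1)] S[OF xy(2)] bij_betw_imp_inj_on[OF h[of "?r y" "cl G y"]] by (auto simp: inj_on_def)
  qed
  have vsF: "F u \<in> vs (blow ?K)" if "u \<in> vs G" for u
    using hl[OF that] that by (simp add: F_def del: score_simps(3))
  have "F ` vs G = vs (blow ?K)"
  proof (intro set_eqI iffI)
    fix x assume "x \<in> F ` vs G"
    then show "x \<in> vs (blow ?K)" using vsF by blast
  next
    fix x assume x: "x \<in> vs (blow ?K)"
    obtain v c i where vi: "x = enc3 v c i" by (rule enc3_cases)
    with x have "i < count (cl ?K v) c" by simp
    then have "i \<in> h v c ` S v c" using h[of v c] by (auto simp: bij_betw_def)
    then obtain u where u: "u \<in> S v c" "i = h v c u" by blast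
    then have "F u = x" "u \<in> vs G" using vi by (auto simp: F_def S_def)
    then show "x \<in> F ` vs G" by blast
  qed
  moreover have "ad (blow ?K) (F x) (F y) \<longleftrightarrow> ad G x y" if xy: "x \<in> vs G" "y \<in> vs G" for x y
  proof -
    have *: "ad (blow ?K) (F x) (F y) \<longleftrightarrow> ?r x \<noteq> ?r y \<and> ad ?K (?r x) (?r y) \<or> ?r x = ?r y \<and> F x \<noteq> F y"
      using hl[OF xy(1)] hl[OF xy(2)] xy by (auto simp: F_def simp del: score_simps(3))
    show ?thesis
    proof (cases "?r x = ?r y")
      case True
      then have "twins \<beta> G x y" using rep_eq_iff xy by blast
      then show ?thesis using * True inj_on_eq_iff[OF inj xy] twins_ad[OF G] conn_cgraphD(4)[OF G] by blast
    next
      case False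
      then show ?thesis using * ad_rep[OF G xy False] xy by simp
    qed
  qed
  moreover have "cl (blow ?K) (F x) = cl G x" for x by (simp add: F_def)
  ultimately have "iso_map F G (blow ?K)" using inj by (simp add: iso_map_def bij_betw_def)
  then show ?thesis unfolding iso_def by blast
qed

lemma content_score: assumes "conn_cgraph G" shows "\<Sum>\<^sub># (content (score \<beta> G)) = content G"
  using content_iso[OF blow_score[OF assms, of \<beta>]] content_blow conn_cgraphD(1)[OF conn_score[OF assms]]
  by metis

lemma score_blow: assumes K: "K \<in> scores \<beta>" shows "score \<beta> (blow K) \<approx> K"
proof -
  let ?G = "blow K" and ?r = "fst \<circ> prod_decode"
  note KD = scoresD[OF K] and G = conn_blow[OF K]
  have r [simp]: "?r (enc3 v c i) = v" for v c i by simp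
  have r_in: "?r x \<in> vs K" if "x \<in> vs ?G" for x using that by (cases x rule: enc3_cases) auto
  have cl_in: "cl ?G x \<in># cl K (?r x)" if "x \<in> vs ?G" for x
    using that by (cases x rule: enc3_cases) (auto, metis count_inI less_nat_zero_code)
  have r_surj: "\<exists>x\<in>vs ?G. ?r x = v" if "v \<in> vs K" for v
  proof -
    obtain c where "c \<in># cl K v" using KD(2)[OF \<open>v \<in> vs K\<close>] by (meson multiset_nonemptyE)
    then have "enc3 v c 0 \<in> vs ?G" using \<open>v \<in> vs K\<close> by simp
    then show ?thesis using r by blast
  qed
  have adG: "ad ?G x y \<longleftrightarrow> ?r x \<noteq> ?r y \<and> ad K (?r x) (?r y) \<or> ?r x = ?r y \<and> x \<noteq> y"
    if "x \<in> vs ?G" "y \<in> vs ?G" for x y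
    using that by (cases x rule: enc3_cases; cases y rule: enc3_cases) auto
  have cnbG: "y \<in> cnb ?G x \<longleftrightarrow> ?r y \<in> cnb K (?r x)" if "x \<in> vs ?G" "y \<in> vs ?G" for x y
    using adG[OF that(2,1)] conn_cgraphD(4)[OF KD(1)] by (auto simp: mem_cnb)
  \<comment> \<open>The twin classes of the blow-up are exactly the cliques over the vertices of
    \<open>K\<close>. Since no clique is empty, equality of closed neighbourhoods descends to
    \<open>K\<close>, where separation applies.\<close>
  have tw: "twins \<beta> ?G x y \<longleftrightarrow> ?r x = ?r y" if xy: "x \<in> vs ?G" "y \<in> vs ?G" for x y
  proof
    assume eq: "?r x = ?r y"
    have "z \<in> cnb ?G x \<longleftrightarrow> z \<in> cnb ?G y" if "z \<in> vs ?G" for z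
      using cnbG[OF xy(1) that] cnbG[OF xy(2) that] eq by simp
    then have cnb_eq: "cnb ?G x = cnb ?G y"
      using cnb_subset[OF G xy(1)] cnb_subset[OF G xy(2)] by blast
    consider "set_mset (cl K (?r x)) \<subseteq> {0, \<beta>}" | c where "cl K (?r x) = {#c#}"
      using KD(3)[OF r_in[OF xy(1)]] by blast
    then show "twins \<beta> ?G x y"
    proof cases
      case 1
      then show ?thesis using cl_in[OF xy(1)] cl_in[OF xy(2)] eq cnb_eq
        by (auto simp: twins_def)
    next
      case 2
      \<comment> \<open>A singleton multiset gives a clique with one vertex only.\<close>
      then have "x = y" using xy eq
        by (cases x rule: enc3_cases; cases y rule: enc3_cases) (auto split: if_splits)
      then show ?thesis by (simp add: twins_def)
    qed
  next
    assume t: "twins \<beta> ?G x y"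
    show "?r x = ?r y"
    proof (cases "x = y")
      case False
      then have c: "cl ?G x \<in> {0, \<beta>}" "cl ?G y \<in> {0, \<beta>}" "cnb ?G x = cnb ?G y"
        using t by (auto simp: twins_def)
      have "set_mset (cl K (?r x)) \<subseteq> {0, \<beta>}" "set_mset (cl K (?r y)) \<subseteq> {0, \<beta>}"
        using KD(3)[OF r_in[OF xy(1)]] KD(3)[OF r_in[OF xy(2)]] cl_in[OF xy(1)] cl_in[OF xy(2)] c(1,2)
        by auto
      moreover have "v \<in> cnb K (?r x) \<longleftrightarrow> v \<in> cnb K (?r y)" if v: "v \<in> vs K" for v
      proof -
        obtain z where z: "z \<in> vs ?G" "?r z = v" using r_surj[OF v] by blast
        then show ?thesis using cnbG[OF xy(1) z(1)] cnbG[OF xy(2) z(1)] c(3) by simp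
      qed
      then have "cnb K (?r x) = cnb K (?r y)"
        using cnb_subset[OF KD(1) r_in[OF xy(1)]] cnb_subset[OF KD(1) r_in[OF xy(2)]] by blast
      ultimately show ?thesis using KD(4) r_in xy by blast
    qed simp
  qed
  have rr: "?r (rep \<beta> ?G x) = ?r x" if "x \<in> vs ?G" for x
    using tw rep_in[OF that] that by blast
  have "bij_betw ?r (vs (score \<beta> ?G)) (vs K)"
    unfolding bij_betw_def
  proof
    show "inj_on ?r (vs (score \<beta> ?G))"
    proof (rule inj_onI)
      fix x y assume xy: "x \<in> vs (score \<beta> ?G)" "y \<in> vs (score \<beta> ?G)" and "?r x = ?r y"
      then obtain u w where uw: "u \<in> vs ?G" "w \<in> vs ?G" "x = rep \<beta> ?G u" "y = rep \<beta> ?G w" by auto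
      then have "?r u = ?r w" using rr \<open>?r x = ?r y\<close> by simp
      then show "x = y" using uw tw rep_eq_iff by blast
    qed
    show "?r ` vs (score \<beta> ?G) = vs K"
    proof (intro set_eqI iffI)
      fix v assume "v \<in> ?r ` vs (score \<beta> ?G)"
      then show "v \<in> vs K" using r_in rep_in(1) by fastforce
    next
      fix v assume "v \<in> vs K"
      then obtain x where x: "x \<in> vs ?G" "?r x = v" using r_surj by blast
      then have "v = ?r (rep \<beta> ?G x)" using rr by simp
      then show "v \<in> ?r ` vs (score \<beta> ?G)" using x by (intro image_eqI) auto
    qed
  qed
  moreover have "ad K (?r x) (?r y) \<longleftrightarrow> ad (score \<beta> ?G) x y"
    if xy: "x \<in> vs (score \<beta> ?G)" "y \<in> vs (score \<beta> ?G)" for x y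
  proof -
    have xy': "x \<in> vs ?G" "y \<in> vs ?G" and "rep \<beta> ?G x = x" "rep \<beta> ?G y = y"
      using xy rep_in(1) by auto
    then have "?r x = ?r y \<Longrightarrow> x = y" using tw rep_eq_iff by metis
    then show ?thesis using adG[OF xy'] xy conn_cgraphD(4)[OF KD(1)] by auto
  qed
  moreover have "cl K (?r x) = cl (score \<beta> ?G) x" if x: "x \<in> vs (score \<beta> ?G)" for x
  proof (rule multiset_eqI)
    fix c
    have x': "x \<in> vs ?G" "rep \<beta> ?G x = x" using x rep_in(1) by auto
    have "{u \<in> vs ?G. rep \<beta> ?G u = x \<and> cl ?G u = c} = {u \<in> vs ?G. ?r u = ?r x \<and> cl ?G u = c}"
      using x' tw[of _ x] rep_eq_iff[of _ ?G x \<beta>] by auto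
    also have "\<dots> = enc3 (?r x) c ` {..<count (cl K (?r x)) c}"
    proof (intro set_eqI)
      fix u
      show "u \<in> {u \<in> vs ?G. ?r u = ?r x \<and> cl ?G u = c} \<longleftrightarrow> u \<in> enc3 (?r x) c ` {..<count (cl K (?r x)) c}"
        using r_in[OF x'(1)] by (cases u rule: enc3_cases) auto
    qed
    finally show "count (cl K (?r x)) c = count (cl (score \<beta> ?G) x) c"
      unfolding count_cl_score[OF G] by (simp add: card_image inj_on_def)
  qed
  ultimately have "iso_map ?r (score \<beta> ?G) K" unfolding iso_map_def by blast
  then show ?thesis unfolding iso_def by blast
qed

lemma blow_iso: assumes "K \<approx> L" shows "blow K \<approx> blow L"
proof -
  from assms obtain g where "iso_map g K L" unfolding iso_def by blast
  note g = iso_mapD[OF this]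
  let ?F = "\<lambda>x. case prod_decode x of (v, i) \<Rightarrow> prod_encode (g v, i)"
  have "bij_betw ?F (vs (blow K)) (vs (blow L))"
    unfolding bij_betw_def
  proof
    show "inj_on ?F (vs (blow K))"
    proof (rule inj_onI)
      fix x y assume "x \<in> vs (blow K)" "y \<in> vs (blow K)" "?F x = ?F y"
      then show "x = y"
        by (cases x rule: enc3_cases; cases y rule: enc3_cases) (auto simp: g(5))
    qed
    show "?F ` vs (blow K) = vs (blow L)"
    proof (intro set_eqI iffI)
      fix x assume "x \<in> ?F ` vs (blow K)"
      then obtain y where "x = ?F y" "y \<in> vs (blow K)" by blast
      then show "x \<in> vs (blow L)"
        by (cases y rule: enc3_cases) (auto simp: g(4,7))
    next
      fix x assume x: "x \<in> vs (blow L)"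
      obtain w c i where wi: "x = enc3 w c i" by (rule enc3_cases)
      then obtain v where "w = g v" "v \<in> vs K" using x g(3) by auto
      then have "x = ?F (enc3 v c i)" "enc3 v c i \<in> vs (blow K)"
        using x wi g(7) by auto
      then show "x \<in> ?F ` vs (blow K)" by blast
    qed
  qed
  moreover have "ad (blow L) (?F x) (?F y) \<longleftrightarrow> ad (blow K) x y"
    if "x \<in> vs (blow K)" "y \<in> vs (blow K)" for x y
    using that
    by (cases x rule: enc3_cases; cases y rule: enc3_cases) (auto simp: g(4,5,6,7))
  moreover have "cl (blow L) (?F x) = cl (blow K) x" if "x \<in> vs (blow K)" for x
    using that by (cases x rule: enc3_cases) auto
  ultimately have "iso_map ?F (blow K) (blow L)" by (simp add: iso_map_def)
  then show ?thesis unfolding iso_def by blast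
qed

lemma score_iso:
  assumes c: "conn_cgraph G" "conn_cgraph H" and "G \<approx> H" shows "score \<beta> G \<approx> score \<beta> H"
proof -
  from assms obtain f where f: "iso_map f G H" unfolding iso_def by blast
  note fD = iso_mapD[OF f]
  have tw: "twins \<beta> H (f u) (f v) \<longleftrightarrow> twins \<beta> G u v" if "u \<in> vs G" "v \<in> vs G" for u v
    using that cnb_eq_iso_map[OF f c] fD(5,7) by (auto simp: twins_def)
  \<comment> \<open>An isomorphism need not send least representatives to least representatives, so
    it is followed by \<open>rep\<close> in \<open>H\<close>.\<close>
  let ?F = "\<lambda>x. rep \<beta> H (f x)"
  have F: "?F x = rep \<beta> H (f u) \<longleftrightarrow> rep \<beta> G u = rep \<beta> G x" if "u \<in> vs G" "x \<in> vs G" for u x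
    using that tw[OF that] rep_eq_iff fD(4) by metis
  have sub: "x \<in> vs G" "rep \<beta> G x = x" if "x \<in> vs (score \<beta> G)" for x using that rep_in(1) by auto
  have "bij_betw ?F (vs (score \<beta> G)) (vs (score \<beta> H))"
    unfolding bij_betw_def
  proof
    show "inj_on ?F (vs (score \<beta> G))"
      using F sub by (intro inj_onI) metis
    have "?F ` vs (score \<beta> G) = ?F ` vs G"
    proof -
      have "?F (rep \<beta> G x) = ?F x" if "x \<in> vs G" for x
        using F[of x "rep \<beta> G x"] that rep_in(1) by simp
      then show ?thesis by (simp add: image_image)
    qed
    also have "\<dots> = vs (score \<beta> H)" by (simp add: fD(3)[symmetric] image_image)
    finally show "?F ` vs (score \<beta> G) = vs (score \<beta> H)" .
  qed
  moreover have "ad (score \<beta> H) (?F x) (?F y) \<longleftrightarrow> ad (score \<beta> G) x y"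
    if xy: "x \<in> vs (score \<beta> G)" "y \<in> vs (score \<beta> G)" for x y
  proof (cases "x = y")
    case True
    then show ?thesis using conn_cgraphD(4)[OF conn_score[OF c(1)]] conn_cgraphD(4)[OF conn_score[OF c(2)]] by blast
  next
    case False
    then have "?F x \<noteq> ?F y" using F sub xy by metis
    then have "ad H (?F x) (?F y) \<longleftrightarrow> ad H (f x) (f y)" using ad_rep[OF c(2)] fD(4) sub xy by blast
    also have "\<dots> \<longleftrightarrow> ad G x y" using fD(6) sub xy by blast
    finally show ?thesis using fD(4)[OF sub(1)[OF xy(1)]] fD(4)[OF sub(1)[OF xy(2)]] xy
      unfolding score_simps by blast
  qed
  moreover have "cl (score \<beta> H) (?F x) = cl (score \<beta> G) x" if x: "x \<in> vs (score \<beta> G)" for x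
  proof (rule multiset_eqI)
    fix d
    have "{u \<in> vs H. rep \<beta> H u = ?F x \<and> cl H u = d} = f ` {u \<in> vs G. rep \<beta> G u = x \<and> cl G u = d}"
      unfolding fD(3)[symmetric] using F[OF _ sub(1)[OF x]] sub(2)[OF x] fD(7) by fastforce
    moreover have "inj_on f {u \<in> vs G. rep \<beta> G u = x \<and> cl G u = d}"
      using fD(2) by (rule inj_on_subset) auto
    ultimately show "count (cl (score \<beta> H) (?F x)) d = count (cl (score \<beta> G) x) d"
      unfolding count_cl_score[OF c(1)] count_cl_score[OF c(2)] by (simp add: card_image)
  qed
  ultimately have "iso_map ?F (score \<beta> G) (score \<beta> H)" unfolding iso_map_def by blast
  then show ?thesis unfolding iso_def by blast
qed


section \<open>Tuft and twin bounds seen in the twin quotient\<close>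

lemma score_singleton_class:
  assumes G: "conn_cgraph G" and x: "x \<in> vs (score \<beta> G)" and cl: "cl (score \<beta> G) x = {#c#}"
  shows "x \<in> vs G" "cl G x = c" "u \<in> vs G \<Longrightarrow> rep \<beta> G u = x \<Longrightarrow> u = x"
proof -
  have x': "x \<in> vs G" "rep \<beta> G x = x" using x rep_in(1) by auto
  then have self: "x \<in> twin_class \<beta> G x" by (simp add: twin_class_def)
  have "card (twin_class \<beta> G x) = 1"
    using arg_cong[OF cl, of size] by simp
  then obtain y where "twin_class \<beta> G x = {y}" by (auto simp: card_1_singleton_iff)
  with self have tc: "twin_class \<beta> G x = {x}" by simp
  show "x \<in> vs G" by fact
  show "cl G x = c" using cl tc by simp
  show "u = x" if "u \<in> vs G" "rep \<beta> G u = x" using that tc by (auto simp: twin_class_def)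
qed

lemma score_singletonI:
  assumes G: "conn_cgraph G" and x: "x \<in> vs G" and "\<And>u. twins \<beta> G u x \<Longrightarrow> u = x"
  shows "x \<in> vs (score \<beta> G)" "cl (score \<beta> G) x = {#cl G x#}" "rep \<beta> G x = x"
proof -
  show r: "rep \<beta> G x = x" using rep_in(2)[OF x] assms(3) by blast
  then show "x \<in> vs (score \<beta> G)" using x by (metis score_simps(1) imageI)
  have "twin_class \<beta> G x = {x}"
    using r x assms(3) rep_eq_iff[OF _ x, of _ \<beta>] by (auto simp: twin_class_def)
  then show "cl (score \<beta> G) x = {#cl G x#}" by simp
qed

text \<open>This is where the two encodings are seen not to interfere: a plain stem and its plain
  leaf both form classes of their own. The stem has to be part of the statement, since a leaf of the
  quotient attached to a class with several members is not a leaf of \<open>G\<close>.\<close>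

lemma tuft_score_iff:
  assumes G: "G \<in> tgraphs"
  shows "cl G v = 0 \<and> ad G v l \<and> zleaf 0 G l \<longleftrightarrow>
    v \<in> vs (score \<beta> G) \<and> cl (score \<beta> G) v = {#0#} \<and> ad (score \<beta> G) v l \<and> zleaf {#0#} (score \<beta> G) l"
proof
  have conn: "conn_cgraph G" using G by (simp add: tgraphs_def)
  note GD = conn_cgraphD[OF conn]
  {
    assume a: "cl G v = 0 \<and> ad G v l \<and> zleaf 0 G l"
    then have v: "v \<in> vs G" "cl G v = 0" and vl: "ad G v l" "ad G l v" and l: "zleaf 0 G l" "l \<in> vs G" "cl G l = 0"
      using GD(2)[of v l] GD(5)[of v l] by (simp_all add: zleaf_def)
    have nb: "ad G l w \<longleftrightarrow> w = v" "ad G w l \<longleftrightarrow> w = v" for w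
      using stem[OF l(1), of w] stem[OF l(1), of v] vl(2) GD(5)[of w l] by simp_all
    have cl: "cnb G l = {l, v}" using nb by (auto simp: mem_cnb)
    \<comment> \<open>Equality would confine all neighbours of \<open>v\<close> to \<open>l\<close>,
      so the graph would be the excluded one.\<close>
    have ne: "cnb G l \<noteq> cnb G v"
    proof
      assume eq: "cnb G l = cnb G v"
      have "vs G = {l, v}"
      proof (rule closed_set_eq_vs[OF conn, of l])
        fix x y assume "x \<in> {l, v}" "ad G x y"
        then show "y \<in> {l, v}" using nb eq cl mem_cnb[of y G v] GD(5) by (metis insertE singletonD)
      qed (use v l in auto)
      moreover have "l \<noteq> v" using GD(4)[OF vl(1)] by simp
      ultimately have "content G = {#0, 0#}" using v l by (simp add: content_def)
      then show False using G by (simp add: tgraphs_def)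
    qed
    \<comment> \<open>A second twin \<open>w\<close> of \<open>v\<close> would contain
      \<open>l\<close> in its closed neighbourhood; as \<open>v\<close> is the only neighbour of
      \<open>l\<close>, this forces \<open>w = l\<close>, against \<open>ne\<close>.\<close>
    have sv: "w = v" if "twins \<beta> G w v" for w
    proof (rule ccontr)
      assume "w \<noteq> v"
      then have eq: "cnb G w = cnb G v" using that by (simp add: twins_def)
      have "l \<in> cnb G w" using eq vl by (simp add: mem_cnb)
      then have "l = w" using nb(1) \<open>w \<noteq> v\<close> by (simp add: mem_cnb)
      then show False using ne eq by simp
    qed
    have sl: "w = l" if "twins \<beta> G w l" for w
    proof (rule ccontr)
      assume "w \<noteq> l"
      then have eq: "cnb G w = cnb G l" using that by (simp add: twins_def)
      have "w \<in> cnb G w" by (simp add: mem_cnb)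
      then show False using \<open>w \<noteq> l\<close> ne eq cl by auto
    qed
    note V = score_singletonI[OF conn v(1) sv] and L = score_singletonI[OF conn l(2) sl]
    have "ad (score \<beta> G) l w \<longleftrightarrow> w = v" for w using V(1) L(1) nb by (auto simp del: image_iff)
    then have "zleaf {#0#} (score \<beta> G) l"
      unfolding zleaf_def using L l by auto
    then show "v \<in> vs (score \<beta> G) \<and> cl (score \<beta> G) v = {#0#} \<and> ad (score \<beta> G) v l \<and> zleaf {#0#} (score \<beta> G) l"
      using V L v vl by simp
  }
  {
    assume a: "v \<in> vs (score \<beta> G) \<and> cl (score \<beta> G) v = {#0#} \<and> ad (score \<beta> G) v l \<and> zleaf {#0#} (score \<beta> G) l"
    then have l: "l \<in> vs (score \<beta> G)" "cl (score \<beta> G) l = {#0#}" by (simp_all add: zleaf_def)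
    from a have v: "v \<in> vs (score \<beta> G)" "cl (score \<beta> G) v = {#0#}" by simp_all
    note V = score_singleton_class[OF conn v] and L = score_singleton_class[OF conn l]
    have vl: "ad G v l" using a by simp
    have lv: "ad G l v" using vl GD(5) by blast
    have lr: "rep \<beta> G l = l" using l(1) by auto
    \<comment> \<open>The class of \<open>l\<close> is a singleton, so \<open>w\<close> lies in
      another class, whose representative is a neighbour of \<open>l\<close> in the quotient and
      hence equals \<open>v\<close>. The class of \<open>v\<close> is a singleton as well.\<close>
    have "w = v" if "ad G l w" for w
    proof -
      have w: "w \<in> vs G" "w \<noteq> l" using GD(3,4)[OF that] by auto
      then have "rep \<beta> G w \<noteq> l" using L(3) by blast
      then have "ad G l (rep \<beta> G w)" using ad_rep[OF conn L(1) w(1), of \<beta>] lr that by simp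
      then have 1: "ad (score \<beta> G) l (rep \<beta> G w)" using l(1) w(1) by simp
      have 2: "ad (score \<beta> G) l v" using lv l(1) v(1) by simp
      have "\<exists>!w. ad (score \<beta> G) l w" using a unfolding zleaf_def by blast
      then have "rep \<beta> G w = v" using 1 2 by blast
      then show ?thesis using V(3) w(1) by blast
    qed
    then show "cl G v = 0 \<and> ad G v l \<and> zleaf 0 G l"
      using V(2) L(1,2) vl lv unfolding zleaf_def by blast
  }
qed

lemma tuft_bounded_score:
  assumes G: "G \<in> tgraphs"
  shows "tuft_bounded 0 b G \<longleftrightarrow> tuft_bounded {#0#} b (score \<beta> G)"
proof -
  note iff = tuft_score_iff[OF G, of _ _ \<beta>]
  have conn: "conn_cgraph G" using G by (simp add: tgraphs_def)
  have eq: "{u. ad G v u \<and> zleaf 0 G u} = {u. ad (score \<beta> G) v u \<and> zleaf {#0#} (score \<beta> G) u}"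
    if "v \<in> vs (score \<beta> G)" "cl (score \<beta> G) v = {#0#}" for v
    using iff[of v] that score_singleton_class(2)[OF conn that] by blast
  show ?thesis
  proof
    assume t: "tuft_bounded 0 b G"
    show "tuft_bounded {#0#} b (score \<beta> G)"
      unfolding tuft_bounded_def
    proof (intro ballI impI)
      fix v assume v: "v \<in> vs (score \<beta> G)" "cl (score \<beta> G) v = {#0#}"
      show "card {u. ad (score \<beta> G) v u \<and> zleaf {#0#} (score \<beta> G) u} \<le> b"
        unfolding eq[OF v, symmetric]
        using t score_singleton_class(1,2)[OF conn v] unfolding tuft_bounded_def by blast
    qed
  next
    assume t: "tuft_bounded {#0#} b (score \<beta> G)"
    show "tuft_bounded 0 b G"
      unfolding tuft_bounded_def
    proof (intro ballI impI)
      fix v assume v: "v \<in> vs G" "cl G v = 0"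
      show "card {u. ad G v u \<and> zleaf 0 G u} \<le> b"
      \<comment> \<open>A plain vertex in a larger class carries no plain leaf and meets the bound
        trivially; any other case is visible in the quotient.\<close>
      proof (cases "{u. ad G v u \<and> zleaf 0 G u} = {}")
        case False
        then have v': "v \<in> vs (score \<beta> G)" "cl (score \<beta> G) v = {#0#}" using iff[of v] v by blast+
        then show ?thesis unfolding eq[OF v'] using t unfolding tuft_bounded_def by blast
      qed (metis card.empty le0)
    qed
  qed
qed

lemma twin_bounded_score:
  assumes G: "conn_cgraph G"
  shows "twin_bounded a G \<longleftrightarrow> (\<forall>d\<in>#content (score \<beta> G). count d 0 \<le> Suc a)"
proof -
  have eq: "{u \<in> vs G. rep \<beta> G u = rep \<beta> G v \<and> cl G u = 0} = {u \<in> vs G. cl G u = 0 \<and> cnb G u = cnb G v}"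
    if "v \<in> vs G" "cl G v = 0" for v
    using that rep_eq_iff[OF _ that(1)] by (auto simp: twins_def)
  have "(\<forall>d\<in>#content (score \<beta> G). count d 0 \<le> Suc a) \<longleftrightarrow>
     (\<forall>v\<in>vs G. card {u \<in> vs G. rep \<beta> G u = rep \<beta> G v \<and> cl G u = 0} \<le> Suc a)"
    using conn_cgraphD(1)[OF G] count_cl_score[OF G, of \<beta> _ 0] by (auto simp: content_def)
  \<comment> \<open>The quotient bounds all classes, the definition only those of plain vertices. A
    class without plain members counts 0, and in any other class a plain member can be used to name
    it.\<close>
  also have "\<dots> \<longleftrightarrow> (\<forall>v\<in>vs G. cl G v = 0 \<longrightarrow> card {u \<in> vs G. rep \<beta> G u = rep \<beta> G v \<and> cl G u = 0} \<le> Suc a)"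
  proof (intro iffI ballI)
    fix v assume *: "\<forall>v\<in>vs G. cl G v = 0 \<longrightarrow> card {u \<in> vs G. rep \<beta> G u = rep \<beta> G v \<and> cl G u = 0} \<le> Suc a"
      and v: "v \<in> vs G"
    show "card {u \<in> vs G. rep \<beta> G u = rep \<beta> G v \<and> cl G u = 0} \<le> Suc a"
    proof (cases "{u \<in> vs G. rep \<beta> G u = rep \<beta> G v \<and> cl G u = 0} = {}")
      case False
      then obtain w where w: "w \<in> vs G" "rep \<beta> G w = rep \<beta> G v" "cl G w = 0" by blast
      show ?thesis using bspec[OF * w(1)] w(2,3) by simp
    qed (metis card.empty le0)
  qed blast
  also have "\<dots> \<longleftrightarrow> twin_bounded a G" unfolding twin_bounded_def using eq by auto
  finally show ?thesis by blast
qed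

lemma tuft_bounded_recolor:
  assumes "\<And>v. v \<in> vs K \<Longrightarrow> \<theta> (cl K v) = z \<longleftrightarrow> cl K v = z"
  shows "tuft_bounded z b (recolor \<theta> K) \<longleftrightarrow> tuft_bounded z b K"
proof -
  have "zleaf z (recolor \<theta> K) = zleaf z K" using assms by (auto simp: zleaf_def fun_eq_iff)
  then show ?thesis using assms by (simp add: tuft_bounded_def)
qed

lemma count_unfold_col:
  "count (unfold_col \<alpha> k M) c = (if c = \<alpha> then 0 else count M c) + (if c = 0 then count M \<alpha> * k else 0)"
  by (induction M) auto

text \<open>Admissible quotients are described by the colours outside 0 and \<beta> alone, apart
  from nonemptiness, so exchanging zeros for \<beta> and back stays inside.\<close>

lemma recolor_in_scores:
  assumes K: "K \<in> scores \<beta>"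
    and "\<And>v. v \<in> vs K \<Longrightarrow> \<theta> (cl K v) \<noteq> {#}"
    and "\<And>v. v \<in> vs K \<Longrightarrow> set_mset (\<theta> (cl K v)) - {0, \<beta>} = set_mset (cl K v) - {0, \<beta>}"
    and "\<And>c. c \<notin> {0, \<beta>} \<Longrightarrow> \<theta> {#c#} = {#c#}"
  shows "recolor \<theta> K \<in> scores \<beta>"
proof -
  note KD = scoresD[OF K]
  have sub: "set_mset (\<theta> (cl K v)) \<subseteq> {0, \<beta>} \<longleftrightarrow> set_mset (cl K v) \<subseteq> {0, \<beta>}" if "v \<in> vs K" for v
    using assms(3)[OF that] by (metis Diff_eq_empty_iff)
  have cnb: "cnb (recolor \<theta> K) v = cnb K v" for v by (simp add: cnb_def)
  have 1: "set_mset (\<theta> (cl K v)) \<subseteq> {0, \<beta>} \<or> (\<exists>c. c \<notin> {0, \<beta>} \<and> \<theta> (cl K v) = {#c#})" if "v \<in> vs K" for v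
    using KD(3)[OF that] sub[OF that] assms(4) by metis
  show ?thesis
    unfolding scores_def mem_Collect_eq recolor_simps cnb comp_apply
    using KD(1,4) sub 1 assms(2) by (simp only: conn_recolor) metis
qed

text \<open>A whole set of contents is allowed because the tuft step ends with all contents that
  decode to \<open>M\<close>. The tuft bound is carried along unchanged, as tufts only involve
  classes coloured \<open>{#0#}\<close>.\<close>

lemma card_types_twin_step:
  assumes \<beta>: "\<beta> \<noteq> 0" "\<And>M. M \<in> \<M> \<Longrightarrow> \<beta> \<notin># M" and two: "{#0, 0#} \<notin> \<M>"
  shows "card (types {G. conn_cgraph G \<and> tuft_bounded 0 b G \<and> content G \<in> \<M>}) =
    card (types {G. conn_cgraph G \<and> tuft_bounded 0 b G \<and> twin_bounded a G \<and>
      unfold_col \<beta> (Suc (Suc a)) (content G) \<in> \<M>})"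
proof -
  define k where "k = Suc (Suc a)"
  \<comment> \<open>Division with remainder by \<open>k = a + 2\<close>: the remainder is at most
    \<open>a + 1\<close>, the bound for plain twins, and the quotient gives the number of \<beta>.
    Uniqueness of quotient and remainder makes decoding the inverse.\<close>
  define \<theta> where "\<theta> d = filter_mset (\<lambda>c. c \<noteq> 0) d + replicate_mset (count d 0 mod k) 0
     + replicate_mset (count d 0 div k) \<beta>" for d :: "nat multiset"
  define A where "A = {K. tuft_bounded {#0#} b K \<and> \<Sum>\<^sub># (content K) \<in> \<M>}"
  define B where "B = {K. tuft_bounded {#0#} b K \<and> (\<forall>d\<in>#content K. count d 0 \<le> Suc a) \<and>
     unfold_col \<beta> k (\<Sum>\<^sub># (content K)) \<in> \<M>}"
  have k: "k \<ge> 2" by (simp add: k_def)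
  have two': "unfold_col \<beta> k M \<notin> \<M>" if "M = {#0, 0#}" for M using that two \<beta>(1) by simp
  have cont: "cl K v \<in># content K" if "K \<in> scores \<beta>" "v \<in> vs K" for K v
    using that(2) in_content[OF conn_cgraphD(1)[OF scoresD(1)[OF that(1)]]] by simp blast
  have no_\<beta>: "\<beta> \<notin># cl K v" if "K \<in> scores \<beta>" "K \<in> A" "v \<in> vs K" for K v
  proof
    assume "\<beta> \<in># cl K v"
    then have "\<beta> \<in># \<Sum>\<^sub># (content K)" using cont[OF that(1,3)] by auto
    then show False using that(2) \<beta>(2) unfolding A_def by blast
  qed
  have small: "count (cl K v) 0 < k" if "K \<in> scores \<beta>" "K \<in> B" "v \<in> vs K" for K v
    using that(2) cont[OF that(1,3)] by (auto simp: B_def k_def)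
  have \<theta>'\<theta>: "unfold_col \<beta> k (\<theta> d) = d" if "\<beta> \<notin># d" for d
    using that \<beta>(1) by (intro multiset_eqI) (auto simp: \<theta>_def count_unfold_col not_in_iff)
  have \<theta>\<theta>': "\<theta> (unfold_col \<beta> k d) = d" if "count d 0 < k" for d
    using that \<beta>(1) by (intro multiset_eqI) (auto simp: \<theta>_def count_unfold_col)
  \<comment> \<open>Here \<open>k \<ge> 2\<close> matters: 1 has quotient 0 and remainder 1, so
    singleton plain classes, and with them the tufts, are untouched.\<close>
  have \<theta>0: "\<theta> {#0#} = {#0#}" using k by (simp add: \<theta>_def)
  have u0: "unfold_col \<beta> k {#0#} = {#0#}" using \<beta>(1) by simp
  have "card (types {G \<in> {G. conn_cgraph G}. score \<beta> G \<in> A}) = card (types {G \<in> {G. conn_cgraph G}. score \<beta> G \<in> B})"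
  proof (rule card_types_eq_via_core[where \<K> = "scores \<beta>" and build = blow and \<theta> = \<theta> and \<theta>' = "unfold_col \<beta> k"])
    show "score \<beta> G \<in> scores \<beta>" if "G \<in> {G. conn_cgraph G}" for G using that score_in_scores by blast
    show "score \<beta> G \<approx> score \<beta> H" if "G \<in> {G. conn_cgraph G}" "H \<in> {G. conn_cgraph G}" "G \<approx> H" for G H
      using that score_iso by blast
    show "blow K \<in> {G. conn_cgraph G}" if "K \<in> scores \<beta>" for K using that conn_blow by blast
    show "blow K \<approx> blow L" if "K \<approx> L" for K L using that by (rule blow_iso)
    show "blow (score \<beta> G) \<approx> G" if "G \<in> {G. conn_cgraph G}" for G using that blow_score iso_sym by blast
    show "score \<beta> (blow K) \<approx> K" if "K \<in> scores \<beta>" for K using that by (rule score_blow)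
    show "L \<in> A" if "K \<in> scores \<beta>" "L \<in> scores \<beta>" "K \<approx> L" "K \<in> A" for K L
      using that content_iso[of K L] tuft_bounded_iso[OF that(3) scoresD(1)[OF that(1)] scoresD(1)[OF that(2)]]
      by (simp add: A_def)
    show "L \<in> B" if "K \<in> scores \<beta>" "L \<in> scores \<beta>" "K \<approx> L" "K \<in> B" for K L
      using that content_iso[of K L] tuft_bounded_iso[OF that(3) scoresD(1)[OF that(1)] scoresD(1)[OF that(2)]]
      by (simp add: B_def)
    fix K assume K: "K \<in> scores \<beta>"
    note KD = scoresD[OF K]
    show "unfold_col \<beta> k (\<theta> (cl K v)) = cl K v" if "K \<in> A" "v \<in> vs K" for v
      using \<theta>'\<theta> no_\<beta> K that by blast
    show "\<theta> (unfold_col \<beta> k (cl K v)) = cl K v" if "K \<in> B" "v \<in> vs K" for v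
      using \<theta>\<theta>' small K that by blast
    show "recolor \<theta> K \<in> scores \<beta> \<inter> B" if A: "K \<in> A"
    proof
      note inv = \<theta>'\<theta>[OF no_\<beta>[OF K A]]
      show "recolor \<theta> K \<in> scores \<beta>"
      proof (rule recolor_in_scores[OF K])
        show "\<theta> (cl K v) \<noteq> {#}" if "v \<in> vs K" for v
          using inv[OF that] KD(2)[OF that] unfold_col_simps(1) by metis
        show "set_mset (\<theta> (cl K v)) - {0, \<beta>} = set_mset (cl K v) - {0, \<beta>}" for v
          by (auto simp: \<theta>_def split: if_splits)
        show "\<theta> {#c#} = {#c#}" if "c \<notin> {0, \<beta>}" for c using that by (simp add: \<theta>_def)
      qed
      have "\<theta> (cl K v) = {#0#} \<longleftrightarrow> cl K v = {#0#}" if "v \<in> vs K" for v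
        using inv[OF that] \<theta>0 u0 by metis
      then have "tuft_bounded {#0#} b (recolor \<theta> K) \<longleftrightarrow> tuft_bounded {#0#} b K"
        by (rule tuft_bounded_recolor)
      then have "tuft_bounded {#0#} b (recolor \<theta> K)" using A by (simp add: A_def)
      moreover have "count (\<theta> d) 0 \<le> Suc a" for d
        using \<beta>(1) mod_less_divisor[of k "count d 0"] by (simp add: \<theta>_def k_def)
      moreover have "unfold_col \<beta> k (\<Sum>\<^sub># (content (recolor \<theta> K))) = \<Sum>\<^sub># (content K)"
      proof -
        have "unfold_col \<beta> k (\<Sum>\<^sub># (content (recolor \<theta> K))) = (\<Sum>d\<in>#content K. unfold_col \<beta> k (\<theta> d))"
          by (simp add: unfold_col_sum)
        also have "\<dots> = (\<Sum>d\<in>#content K. d)"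
          using inv in_content[OF conn_cgraphD(1)[OF KD(1)]]
          by (intro arg_cong[where f = sum_mset] image_mset_cong) auto
        finally show ?thesis by simp
      qed
      ultimately show "recolor \<theta> K \<in> B" using A by (auto simp: B_def A_def)
    qed
    show "recolor (unfold_col \<beta> k) K \<in> scores \<beta> \<inter> A" if B: "K \<in> B"
    proof
      note inv = \<theta>\<theta>'[OF small[OF K B]]
      show "recolor (unfold_col \<beta> k) K \<in> scores \<beta>"
      proof (rule recolor_in_scores[OF K])
        have "\<theta> {#} = {#}" by (simp add: \<theta>_def)
        then show "unfold_col \<beta> k (cl K v) \<noteq> {#}" if "v \<in> vs K" for v
          using inv[OF that] KD(2)[OF that] by metis
        show "set_mset (unfold_col \<beta> k (cl K v)) - {0, \<beta>} = set_mset (cl K v) - {0, \<beta>}" for v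
          unfolding set_mset_def by (auto simp: count_unfold_col)
        show "unfold_col \<beta> k {#c#} = {#c#}" if "c \<notin> {0, \<beta>}" for c using that by simp
      qed
      have "unfold_col \<beta> k (cl K v) = {#0#} \<longleftrightarrow> cl K v = {#0#}" if "v \<in> vs K" for v
        using inv[OF that] \<theta>0 u0 by metis
      then have "tuft_bounded {#0#} b (recolor (unfold_col \<beta> k) K) \<longleftrightarrow> tuft_bounded {#0#} b K"
        by (rule tuft_bounded_recolor)
      then have "tuft_bounded {#0#} b (recolor (unfold_col \<beta> k) K)" using B by (simp add: B_def)
      moreover have "\<Sum>\<^sub># (content (recolor (unfold_col \<beta> k) K)) = unfold_col \<beta> k (\<Sum>\<^sub># (content K))"
        using unfold_col_sum[of \<beta> k "\<lambda>d. d" "content K"] by simp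
      ultimately show "recolor (unfold_col \<beta> k) K \<in> A" using B by (simp add: A_def B_def)
    qed
  qed
  moreover have "{G \<in> {G. conn_cgraph G}. score \<beta> G \<in> A} = {G. conn_cgraph G \<and> tuft_bounded 0 b G \<and> content G \<in> \<M>}"
  proof -
    \<comment> \<open>The tuft bound may change in the quotient of the excluded graph, so that
      content is treated apart; it lies on neither side.\<close>
    have "score \<beta> G \<in> A \<longleftrightarrow> tuft_bounded 0 b G \<and> content G \<in> \<M>" if "conn_cgraph G" for G
    proof (cases "content G = {#0, 0#}")
      case False
      then have "G \<in> tgraphs" using that by (simp add: tgraphs_def)
      then show ?thesis using tuft_bounded_score[of G b \<beta>] content_score[OF that, of \<beta>] by (simp add: A_def)
    qed (use two content_score[OF that] in \<open>simp add: A_def\<close>)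
    then show ?thesis by blast
  qed
  moreover have "{G \<in> {G. conn_cgraph G}. score \<beta> G \<in> B} = {G. conn_cgraph G \<and> tuft_bounded 0 b G \<and> twin_bounded a G \<and>
      unfold_col \<beta> (Suc (Suc a)) (content G) \<in> \<M>}"
  proof -
    have "score \<beta> G \<in> B \<longleftrightarrow> tuft_bounded 0 b G \<and> twin_bounded a G \<and> unfold_col \<beta> k (content G) \<in> \<M>"
      if "conn_cgraph G" for G
    proof (cases "content G = {#0, 0#}")
      case False
      then have "G \<in> tgraphs" using that by (simp add: tgraphs_def)
      then show ?thesis
        using tuft_bounded_score[of G b \<beta>] content_score[OF that, of \<beta>] twin_bounded_score[OF that, of a \<beta>]
        by (auto simp: B_def)
    next
      case True
      then show ?thesis using two'[OF True] content_score[OF that, of \<beta>] by (simp add: B_def)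
    qed
    then show ?thesis unfolding k_def by blast
  qed
  ultimately show ?thesis by simp
qed

section \<open>Symmetry for coloured graphs\<close>

definition bounded_graphs :: "nat \<Rightarrow> nat \<Rightarrow> nat multiset \<Rightarrow> nat cgraph set" where
  "bounded_graphs a b M =
     {G. conn_cgraph G \<and> tuft_bounded 0 b G \<and> twin_bounded a G \<and> content G = M}"

text \<open>Cardinalities of unions split into sums only for finite sets. Every type has a member on
  \<open>{..<n}\<close>, which is given by a binary relation and a list of colours from
  \<open>M\<close>.\<close>

lemma finite_types_content: "finite (types {G. conn_cgraph G \<and> content G = (M :: nat multiset)})"
proof -
  define n where "n = size M"
  define mk where "mk = (\<lambda>(R, l). \<lparr>vs = {..<n}, ad = (\<lambda>x y. (x, y) \<in> R), cl = (\<lambda>i. l ! i)\<rparr> :: nat cgraph)"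
  define D where "D = Pow ({..<n} \<times> {..<n}) \<times> {l. set l \<subseteq> set_mset M \<and> length l = n}"
  have "finite D" unfolding D_def by (intro finite_SigmaI) (auto intro: finite_lists_length_eq)
  moreover have "types {G. conn_cgraph G \<and> content G = M} \<subseteq> (\<lambda>p. {H. mk p \<approx> H}) ` D"
  proof
    fix X assume "X \<in> types {G. conn_cgraph G \<and> content G = M}"
    then obtain G where G: "conn_cgraph G" "content G = M" "X = {H. G \<approx> H}"
      unfolding types_def by blast
    have fin: "finite (vs G)" using conn_cgraphD(1)[OF G(1)] .
    have "card (vs G) = n" using G(2) by (auto simp: n_def content_def)
    then obtain g where g: "bij_betw g {..<n} (vs G)"
      using finite_same_card_bij[of "{..<n}" "vs G"] fin by auto
    define p where "p = ({(x, y). x < n \<and> y < n \<and> ad G (g x) (g y)}, map (\<lambda>i. cl G (g i)) [0..<n])"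
    have "cl G (g i) \<in># M" if "i < n" for i
    proof -
      have "g i \<in> vs G" using g that by (auto simp: bij_betw_def)
      then show ?thesis unfolding G(2)[symmetric] in_content[OF fin] by blast
    qed
    then have "p \<in> D" by (auto simp: D_def p_def)
    moreover have "iso_map g (mk p) G" using g by (simp add: iso_map_def mk_def p_def)
    then have "mk p \<approx> G" unfolding iso_def by blast
    then have "X = {H. mk p \<approx> H}" unfolding G(3) iso_class_eq by (rule iso_sym)
    ultimately show "X \<in> (\<lambda>p. {H. mk p \<approx> H}) ` D" by blast
  qed
  ultimately show ?thesis by (rule finite_surj)
qed

lemma finite_types_bounded: "finite (types (bounded_graphs a b M))"
  by (rule finite_subset[OF _ finite_types_content[of M]]) (auto simp: types_def bounded_graphs_def)

lemma card_types_UN: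
  assumes "finite I" and "\<And>M. M \<in> I \<Longrightarrow> finite (types (X M))"
    and "\<And>M G. M \<in> I \<Longrightarrow> G \<in> X M \<Longrightarrow> content G = M"
  shows "card (types (\<Union>M\<in>I. X M)) = (\<Sum>M\<in>I. card (types (X M)))"
proof -
  have "types (\<Union>M\<in>I. X M) = (\<Union>M\<in>I. types (X M))" by (auto simp: types_def)
  moreover have "types (X M) \<inter> types (X N) = {}" if "M \<in> I" "N \<in> I" "M \<noteq> N" for M N
  proof (rule ccontr)
    assume "types (X M) \<inter> types (X N) \<noteq> {}"
    then obtain G H where "G \<in> X M" "H \<in> X N" "{K. G \<approx> K} = {K. H \<approx> K}" unfolding types_def by blast
    then show False using that assms(3) content_iso unfolding iso_class_eq by metis
  qed
  ultimately show ?thesis using assms(1,2) by (simp add: card_UN_disjoint)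
qed

lemma unfold_col_commute:
  "\<alpha> \<noteq> \<beta> \<Longrightarrow> \<alpha> \<noteq> 0 \<Longrightarrow> \<beta> \<noteq> 0 \<Longrightarrow> unfold_col \<alpha> k (unfold_col \<beta> j N) = unfold_col \<beta> j (unfold_col \<alpha> k N)"
  by (rule multiset_eqI) (auto simp: count_unfold_col)

text \<open>Tufts are encoded before twins because the twin step preserves a tuft bound. The final
  graphs are sorted by their content \<open>N\<close>, which decodes to \<open>M\<close>.\<close>

lemma card_types_total:
  assumes col: "\<alpha> \<noteq> \<beta>" "\<alpha> \<noteq> 0" "\<beta> \<noteq> 0" "\<alpha> \<notin># M" "\<beta> \<notin># M" and M: "M \<noteq> {#0, 0#}"
    and fin: "finite {N. unfold_col \<alpha> (Suc (Suc b)) (unfold_col \<beta> (Suc (Suc a)) N) = M}"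
  shows "card (types {G. conn_cgraph G \<and> content G = M}) =
    (\<Sum>N | unfold_col \<alpha> (Suc (Suc b)) (unfold_col \<beta> (Suc (Suc a)) N) = M. card (types (bounded_graphs a b N)))"
proof -
  define \<M> where "\<M> = {N. unfold_col \<alpha> (Suc (Suc b)) N = M}"
  have "card (types {G. conn_cgraph G \<and> content G = M}) =
      card (types {G. conn_cgraph G \<and> tuft_bounded 0 b G \<and> content G \<in> \<M>})"
    using card_types_tuft_step[OF col(2,4) M] by (simp add: \<M>_def)
  also have "\<dots> = card (types {G. conn_cgraph G \<and> tuft_bounded 0 b G \<and> twin_bounded a G \<and>
      unfold_col \<beta> (Suc (Suc a)) (content G) \<in> \<M>})"
  proof (rule card_types_twin_step[OF col(3)])
    \<comment> \<open>Decoding \<alpha> produces only zeros and so does not change the multiplicity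
      of \<beta>, which is 0 in \<open>M\<close>.\<close>
    show "\<beta> \<notin># N" if "N \<in> \<M>" for N
    proof -
      have "count (unfold_col \<alpha> (Suc (Suc b)) N) \<beta> = count N \<beta>" using col by (simp add: count_unfold_col)
      then show ?thesis using that col(5) by (simp add: \<M>_def not_in_iff)
    qed
    show "{#0, 0#} \<notin> \<M>" using M col by (simp add: \<M>_def)
  qed
  also have "{G. conn_cgraph G \<and> tuft_bounded 0 b G \<and> twin_bounded a G \<and>
      unfold_col \<beta> (Suc (Suc a)) (content G) \<in> \<M>} =
      (\<Union>N\<in>{N. unfold_col \<alpha> (Suc (Suc b)) (unfold_col \<beta> (Suc (Suc a)) N) = M}. bounded_graphs a b N)"
    by (auto simp: \<M>_def bounded_graphs_def)
  also have "card (types \<dots>) = (\<Sum>N | unfold_col \<alpha> (Suc (Suc b)) (unfold_col \<beta> (Suc (Suc a)) N) = M.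
      card (types (bounded_graphs a b N)))"
    by (rule card_types_UN[OF fin finite_types_bounded]) (simp add: bounded_graphs_def)
  finally show ?thesis .
qed

lemma finite_multisets_bounded:
  assumes "finite A" shows "finite {N. set_mset N \<subseteq> A \<and> size N \<le> k}"
proof (rule finite_subset)
  show "{N. set_mset N \<subseteq> A \<and> size N \<le> k} \<subseteq> mset ` {xs. set xs \<subseteq> A \<and> length xs \<le> k}"
  proof
    fix N assume "N \<in> {N. set_mset N \<subseteq> A \<and> size N \<le> k}"
    moreover obtain xs where "mset xs = N" using ex_mset by blast
    ultimately show "N \<in> mset ` {xs. set xs \<subseteq> A \<and> length xs \<le> k}" by auto
  qed
qed (simp add: finite_lists_length_le[OF assms])

lemma size_le_unfold_col: "k > 0 \<Longrightarrow> size N \<le> size (unfold_col \<alpha> k N)"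
  by (induction N) auto

lemma set_mset_unfold_col: "set_mset N \<subseteq> insert \<alpha> (set_mset (unfold_col \<alpha> k N))"
  by (induction N) auto

text \<open>Both sums below evaluate the same total over the same index set. All summands but the
  one for \<open>M\<close> agree by induction, so the remaining ones agree too.\<close>

lemma card_types_bounded_sym:
  assumes "M \<noteq> {#0, 0#}"
  shows "card (types (bounded_graphs a b M)) = card (types (bounded_graphs b a M))"
  using assms
proof (induction "count M 0" arbitrary: M rule: less_induct)
  case less
  obtain \<alpha> where \<alpha>: "\<alpha> \<notin> insert 0 (set_mset M)"
    using ex_new_if_finite[of "insert 0 (set_mset M)"] by auto
  obtain \<beta> where \<beta>: "\<beta> \<notin> insert \<alpha> (insert 0 (set_mset M))"
    using ex_new_if_finite[of "insert \<alpha> (insert 0 (set_mset M))"] by auto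
  have col: "\<alpha> \<noteq> \<beta>" "\<beta> \<noteq> \<alpha>" "\<alpha> \<noteq> 0" "\<beta> \<noteq> 0" "\<alpha> \<notin># M" "\<beta> \<notin># M" using \<alpha> \<beta> by auto
  define u where "u N = unfold_col \<alpha> (Suc (Suc b)) (unfold_col \<beta> (Suc (Suc a)) N)" for N
  \<comment> \<open>The decodings commute since each produces only zeros, so the index set can be
    read with the roles of \<alpha> and \<beta> exchanged.\<close>
  have u': "u N = unfold_col \<beta> (Suc (Suc a)) (unfold_col \<alpha> (Suc (Suc b)) N)" for N
    unfolding u_def using col by (intro unfold_col_commute) auto
  let ?I = "{N. u N = M}"
  have "?I \<subseteq> {N. set_mset N \<subseteq> insert \<alpha> (insert \<beta> (set_mset M)) \<and> size N \<le> size M}"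
  proof
    fix N assume "N \<in> ?I"
    then have N: "u N = M" by simp
    have "size N \<le> size (unfold_col \<beta> (Suc (Suc a)) N)" by (simp add: size_le_unfold_col)
    also have "\<dots> \<le> size M" using size_le_unfold_col[of "Suc (Suc b)"] N by (metis u_def zero_less_Suc)
    finally have "size N \<le> size M" .
    moreover have "set_mset N \<subseteq> insert \<alpha> (insert \<beta> (set_mset M))"
      using set_mset_unfold_col[of N \<beta> "Suc (Suc a)"]
        set_mset_unfold_col[of "unfold_col \<beta> (Suc (Suc a)) N" \<alpha> "Suc (Suc b)"] N unfolding u_def by blast
    ultimately show "N \<in> {N. set_mset N \<subseteq> insert \<alpha> (insert \<beta> (set_mset M)) \<and> size N \<le> size M}" by simp
  qed
  then have fin: "finite ?I" by (rule finite_subset) (simp add: finite_multisets_bounded)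
  have MI: "M \<in> ?I" using col by (simp add: u_def unfold_col_fresh)
  have "(\<Sum>N\<in>?I. card (types (bounded_graphs a b N))) = card (types {G. conn_cgraph G \<and> content G = M})"
    using card_types_total[OF col(1,3,4,5,6) less.prems] fin unfolding u_def by simp
  \<comment> \<open>The total does not mention the bounds. It is expanded a second time with
    \<open>a\<close> and \<open>b\<close> exchanged and with \<beta> now encoding the tufts,
    \<alpha> the twins.\<close>
  also have "\<dots> = (\<Sum>N\<in>?I. card (types (bounded_graphs b a N)))"
    using card_types_total[OF col(2,4,3,6,5) less.prems] fin unfolding u' by simp
  finally have sums: "(\<Sum>N\<in>?I. card (types (bounded_graphs a b N))) = (\<Sum>N\<in>?I. card (types (bounded_graphs b a N)))" .
  have "(\<Sum>N\<in>?I - {M}. card (types (bounded_graphs a b N))) = (\<Sum>N\<in>?I - {M}. card (types (bounded_graphs b a N)))"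
  proof (rule sum.cong[OF refl])
    fix N assume "N \<in> ?I - {M}"
    then have N: "u N = M" "N \<noteq> M" by auto
    have "\<alpha> \<in># N \<or> \<beta> \<in># N" using N unfold_col_fresh unfolding u_def by metis
    then have pos: "count N \<alpha> > 0 \<or> count N \<beta> > 0" by simp
    \<comment> \<open>Every \<alpha> or \<beta> in \<open>N\<close> accounts for at least two zeros
      of \<open>M\<close>, so \<open>N\<close> has strictly fewer.\<close>
    have "count M 0 = count N 0 + count N \<beta> * Suc (Suc a) + count N \<alpha> * Suc (Suc b)"
      using N(1)[symmetric] col by (simp add: u_def count_unfold_col)
    then have "count N 0 < count M 0" using pos by auto
    moreover have "N \<noteq> {#0, 0#}" using pos col by auto
    ultimately show "card (types (bounded_graphs a b N)) = card (types (bounded_graphs b a N))"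
      using less.hyps by blast
  qed
  then show ?case using sums sum.remove[OF fin MI] by (metis add_right_cancel)
qed

section \<open>Uncoloured graphs\<close>

definition of_edges :: "nat \<Rightarrow> nat set set \<Rightarrow> nat cgraph" where
  "of_edges n E = \<lparr>vs = {..<n}, ad = (\<lambda>u v. {u, v} \<in> E), cl = (\<lambda>_. 0)\<rparr>"

lemma of_edges_simps [simp]:
  "vs (of_edges n E) = {..<n}" "ad (of_edges n E) = (\<lambda>u v. {u, v} \<in> E)" "cl (of_edges n E) = (\<lambda>_. 0)"
  by (simp_all add: of_edges_def)

lemma simple_graphs_edge:
  assumes "E \<in> simple_graphs n" "e \<in> E"
  obtains u v where "e = {u, v}" "u < n" "v < n" "u \<noteq> v"
proof -
  have "e \<subseteq> {..<n}" "card e = 2" using assms by (auto simp: simple_graphs_def)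
  then show ?thesis using that by (auto simp: card_2_iff)
qed

lemma simple_graphs_edgeD:
  assumes "E \<in> simple_graphs n" "{u, v} \<in> E" shows "u < n" "v < n" "u \<noteq> v"
  using assms unfolding simple_graphs_def by (fastforce simp: card_insert_if)+

lemma conn_of_edges: "E \<in> simple_graphs n \<Longrightarrow> conn_cgraph (of_edges n E) \<longleftrightarrow> E \<in> conn_graphs n"
proof -
  assume E: "E \<in> simple_graphs n"
  have "(ad (of_edges n E))\<^sup>*\<^sup>* u v \<longleftrightarrow> (u, v) \<in> {(a, b). {a, b} \<in> E}\<^sup>*" for u v
    using rtranclp_rtrancl_eq[of "\<lambda>a b. {a, b} \<in> E"] by simp
  then show ?thesis
    using E simple_graphs_edgeD[OF E]
    by (auto simp: conn_cgraph_def conn_graphs_def connected_graph_def insert_commute)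
qed

lemma of_edges_iso_iff:
  assumes E: "E \<in> simple_graphs n" and E': "E' \<in> simple_graphs n"
  shows "of_edges n E \<approx> of_edges n E' \<longleftrightarrow> graph_iso n E E'"
proof
  assume "of_edges n E \<approx> of_edges n E'"
  then obtain f where "iso_map f (of_edges n E) (of_edges n E')" unfolding iso_def by blast
  note f = iso_mapD[OF this, simplified]
  have "E' = (\<lambda>e. f ` e) ` E"
  proof (intro set_eqI iffI)
    fix e assume e: "e \<in> E'"
    then obtain x y where xy: "e = {x, y}" "x < n" "y < n" using simple_graphs_edge[OF E'] by metis
    then obtain u v where uv: "x = f u" "y = f v" "u < n" "v < n"
      using f(3) by (metis imageE lessThan_iff)
    then have "{u, v} \<in> E" using f(6) e xy by simp
    moreover have "e = f ` {u, v}" using xy uv by simp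
    ultimately show "e \<in> (\<lambda>e. f ` e) ` E" by blast
  next
    fix e assume "e \<in> (\<lambda>e. f ` e) ` E"
    then obtain d where d: "d \<in> E" "e = f ` d" by blast
    then obtain u v where "d = {u, v}" "u < n" "v < n" using simple_graphs_edge[OF E] by metis
    then show "e \<in> E'" using d f(6) by simp
  qed
  then show "graph_iso n E E'" unfolding graph_iso_def using f(1) by blast
next
  assume "graph_iso n E E'"
  then obtain f where f: "bij_betw f {..<n} {..<n}" "E' = (\<lambda>e. f ` e) ` E" unfolding graph_iso_def by blast
  have "{f u, f v} \<in> E' \<longleftrightarrow> {u, v} \<in> E" if "u < n" "v < n" for u v
  proof
    assume "{f u, f v} \<in> E'"
    then obtain d where d: "d \<in> E" "f ` {u, v} = f ` d" using f(2) by auto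
    have "d \<subseteq> {..<n}" using d E by (auto simp: simple_graphs_def)
    then have "{u, v} = d"
      using d(2) that inj_on_image_eq_iff[OF bij_betw_imp_inj_on[OF f(1)], of "{u, v}" d] by simp
    then show "{u, v} \<in> E" using d by simp
  next
    assume "{u, v} \<in> E"
    then have "f ` {u, v} \<in> E'" using f(2) by blast
    then show "{f u, f v} \<in> E'" by simp
  qed
  then have "iso_map f (of_edges n E) (of_edges n E')" using f(1) by (simp add: iso_map_def)
  then show "of_edges n E \<approx> of_edges n E'" unfolding iso_def by blast
qed

text \<open>The bound can be read from the content of the twin quotient, which is invariant; 1 is
  just some value for \<beta>.\<close>

lemma twin_bounded_iso:
  assumes "G \<approx> H" "conn_cgraph G" "conn_cgraph H"
  shows "twin_bounded a G \<longleftrightarrow> twin_bounded a H"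
  using twin_bounded_score[of _ a 1] content_iso[OF score_iso[of G H 1]] assms by simp

text \<open>The subtracted 1 moves to the other side as the \<open>Suc\<close> in
  \<open>twin_bounded\<close>. For \<open>n = 0\<close> both sides hold, since the maximum is then
  taken over 0 alone.\<close>

lemma sib_le_iff: "sib n E \<le> a \<longleftrightarrow> twin_bounded a (of_edges n E)"
proof -
  have "closed_nbhd E v = cnb (of_edges n E) v" for v
    by (simp add: closed_nbhd_def nbhd_def cnb_def)
  then show ?thesis by (auto simp: sib_def twin_bounded_def le_diff_conv)
qed

lemma tuft_le_iff: "E \<in> simple_graphs n \<Longrightarrow> tuft n E \<le> b \<longleftrightarrow> tuft_bounded 0 b (of_edges n E)"
proof -
  assume E: "E \<in> simple_graphs n"
  have "is_leaf E u \<longleftrightarrow> zleaf 0 (of_edges n E) u" if "{v, u} \<in> E" for u v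
    using simple_graphs_edgeD[OF E that] unfolding is_leaf_def nbhd_def zleaf_def ex1_iff_card
    by (simp add: insert_commute)
  then have "{u \<in> nbhd E v. is_leaf E u} = {u. ad (of_edges n E) v u \<and> zleaf 0 (of_edges n E) u}" for v
    by (auto simp: nbhd_def insert_commute)
  then show ?thesis by (auto simp: tuft_def tuft_bounded_def)
qed

section \<open>Isomorphism classes of edge sets and types of all-plain graphs\<close>

definition iso_class :: "nat \<Rightarrow> nat set set \<Rightarrow> nat set set set" where
  "iso_class n E = {H \<in> conn_graphs n. graph_iso n E H}"

lemma conn_graphsD: "E \<in> conn_graphs n \<Longrightarrow> E \<in> simple_graphs n" "E \<in> conn_graphs n \<Longrightarrow> conn_cgraph (of_edges n E)"
  using conn_of_edges by (auto simp: conn_graphs_def)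

lemma iso_class_eq_iff:
  assumes "E \<in> conn_graphs n" "E' \<in> conn_graphs n"
  shows "iso_class n E = iso_class n E' \<longleftrightarrow> of_edges n E \<approx> of_edges n E'"
proof -
  have *: "iso_class n E = {H \<in> conn_graphs n. of_edges n E \<approx> of_edges n H}" if "E \<in> conn_graphs n" for E
    using that of_edges_iso_iff conn_graphsD(1) unfolding iso_class_def by blast
  show ?thesis
  proof
    assume "iso_class n E = iso_class n E'"
    then have "E' \<in> {H \<in> conn_graphs n. of_edges n E \<approx> of_edges n H}" using * assms iso_refl by blast
    then show "of_edges n E \<approx> of_edges n E'" by simp
  next
    assume "of_edges n E \<approx> of_edges n E'"
    then have "of_edges n E \<approx> of_edges n H \<longleftrightarrow> of_edges n E' \<approx> of_edges n H" for H
      using iso_sym iso_trans by metis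
    then show "iso_class n E = iso_class n E'" using * assms by simp
  qed
qed

text \<open>Pulling adjacency back along any numbering of the vertices shows that every connected
  all-plain graph comes from an edge set; no types are missed when passing to
  \<open>of_edges\<close>.\<close>

lemma monochromatic_embed:
  assumes H: "conn_cgraph H" and c: "content H = replicate_mset n 0"
  obtains E where "E \<in> conn_graphs n" "of_edges n E \<approx> H"
proof -
  note HD = conn_cgraphD[OF H]
  have "card (vs H) = n" using arg_cong[OF c, of size] by (simp add: content_def)
  then obtain g where g: "bij_betw g {..<n} (vs H)"
    using finite_same_card_bij[of "{..<n}" "vs H"] HD(1) by auto
  have g_in: "g u \<in> vs H" if "u < n" for u using g that by (auto simp: bij_betw_def)
  have cl0: "cl H v = 0" if "v \<in> vs H" for v
  proof -
    have "cl H v \<in># content H" using that in_content[OF HD(1)] by blast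
    then show ?thesis unfolding c by (simp split: if_splits)
  qed
  define E where "E = {{u, v} | u v. u < n \<and> v < n \<and> ad H (g u) (g v)}"
  have E: "{u, v} \<in> E \<longleftrightarrow> u < n \<and> v < n \<and> ad H (g u) (g v)" for u v
    using HD(5) by (auto simp: E_def doubleton_eq_iff)
  have simple: "E \<in> simple_graphs n"
    using HD(4) by (fastforce simp: simple_graphs_def E_def card_insert_if)
  have iso: "iso_map g (of_edges n E) H"
    using g cl0 g_in E by (simp add: iso_map_def)
  note gi = iso_mapD[OF iso_map_inv[OF iso]]
  have "conn_cgraph (of_edges n E)"
    unfolding conn_cgraph_def
  proof (intro conjI ballI)
    fix x y assume xy: "x \<in> vs (of_edges n E)" "y \<in> vs (of_edges n E)"
    have "(ad H)\<^sup>*\<^sup>* (g x) (g y)" using HD(6) g_in xy by simp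
    then have "(ad (of_edges n E))\<^sup>*\<^sup>* (inv_into (vs (of_edges n E)) g (g x)) (inv_into (vs (of_edges n E)) g (g y))"
      by (rule rtranclp_map) (use gi(6) HD(2,3) in blast)
    then show "(ad (of_edges n E))\<^sup>*\<^sup>* x y"
      using xy bij_betw_imp_inj_on[OF g] by (simp add: inv_into_f_f)
  qed (use simple_graphs_edgeD[OF simple] in \<open>auto simp: insert_commute\<close>)
  then have "E \<in> conn_graphs n" using conn_of_edges simple by blast
  then show ?thesis using that iso unfolding iso_def by blast
qed

lemma content_of_edges: "content (of_edges n E) = replicate_mset n 0"
  by (simp add: content_def image_mset_const_eq)

lemma card_bounded_classes:
  "card (iso_class n ` {E \<in> conn_graphs n. sib n E \<le> a \<and> tuft n E \<le> b}) =
   card (types (bounded_graphs a b (replicate_mset n 0)))"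
  unfolding types_def
proof (rule card_image_eq_rel[where r = "\<lambda>E H. of_edges n E \<approx> H"])
  show "\<exists>H\<in>bounded_graphs a b (replicate_mset n 0). of_edges n E \<approx> H"
    if "E \<in> {E \<in> conn_graphs n. sib n E \<le> a \<and> tuft n E \<le> b}" for E
  proof
    show "of_edges n E \<in> bounded_graphs a b (replicate_mset n 0)"
      using that tuft_le_iff[OF conn_graphsD(1), of E n b] conn_graphsD(2)[of E n]
      by (simp add: bounded_graphs_def content_of_edges sib_le_iff)
  qed simp
  show "\<exists>E\<in>{E \<in> conn_graphs n. sib n E \<le> a \<and> tuft n E \<le> b}. of_edges n E \<approx> H"
    if "H \<in> bounded_graphs a b (replicate_mset n 0)" for H
  proof -
    have H: "conn_cgraph H" "content H = replicate_mset n 0" "tuft_bounded 0 b H" "twin_bounded a H"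
      using that by (auto simp: bounded_graphs_def)
    obtain E where E: "E \<in> conn_graphs n" "of_edges n E \<approx> H" using monochromatic_embed[OF H(1,2)] by blast
    then have "sib n E \<le> a" "tuft n E \<le> b"
      using H sib_le_iff tuft_le_iff twin_bounded_iso[OF E(2)] tuft_bounded_iso[OF E(2)] conn_graphsD[OF E(1)]
      by blast+
    then show ?thesis using E by blast
  qed
  fix E H E' H'
  assume "E \<in> {E \<in> conn_graphs n. sib n E \<le> a \<and> tuft n E \<le> b}"
    "E' \<in> {E \<in> conn_graphs n. sib n E \<le> a \<and> tuft n E \<le> b}" and iso: "of_edges n E \<approx> H" "of_edges n E' \<approx> H'"
  then have "iso_class n E = iso_class n E' \<longleftrightarrow> of_edges n E \<approx> of_edges n E'" using iso_class_eq_iff by blast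
  also have "\<dots> \<longleftrightarrow> H \<approx> H'" using iso iso_sym iso_trans by metis
  finally show "iso_class n E = iso_class n E' \<longleftrightarrow> {K. H \<approx> K} = {K. H' \<approx> K}" unfolding iso_class_eq .
qed

lemma sib_tuft_iso_class:
  assumes "E \<in> conn_graphs n" "E' \<in> conn_graphs n" "iso_class n E = iso_class n E'"
  shows "sib n E = sib n E'" "tuft n E = tuft n E'"
proof -
  have iso: "of_edges n E \<approx> of_edges n E'" using iso_class_eq_iff assms by blast
  \<comment> \<open>A number is determined by its upper bounds, and upper bounds are what has been
    expressed in invariant terms.\<close>
  have "sib n E \<le> a \<longleftrightarrow> sib n E' \<le> a" for a
    using twin_bounded_iso[OF iso] conn_graphsD(2) assms sib_le_iff by blast
  then show "sib n E = sib n E'" by (meson order_antisym order_refl)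
  have "tuft n E \<le> a \<longleftrightarrow> tuft n E' \<le> a" for a
    using tuft_bounded_iso[OF iso] conn_graphsD assms tuft_le_iff by blast
  then show "tuft n E = tuft n E'" by (meson order_antisym order_refl)
qed

section \<open>From bounds to exact values\<close>

lemma count_st_alt:
  "count_st n a b = card (iso_class n ` {E \<in> conn_graphs n. sib n E = a \<and> tuft n E = b})"
  unfolding count_st_def iso_class_def by (rule arg_cong[where f = card]) blast

lemma finite_conn_graphs: "finite (conn_graphs n)"
  by (rule finite_subset[of _ "Pow (Pow {..<n})"]) (auto simp: conn_graphs_def simple_graphs_def)

text \<open>The two numbers are invariants of the class, so classes with different pairs are
  distinct and the count below a pair of bounds is a sum over a rectangle.\<close>

lemma sum_count_st:
  "(\<Sum>i\<le>a. \<Sum>j\<le>b. count_st n i j) = card (iso_class n ` {E \<in> conn_graphs n. sib n E \<le> a \<and> tuft n E \<le> b})"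
proof -
  let ?X = "\<lambda>(i, j). iso_class n ` {E \<in> conn_graphs n. sib n E = i \<and> tuft n E = j}"
  have "(\<Sum>i\<le>a. \<Sum>j\<le>b. count_st n i j) = (\<Sum>p\<in>{..a} \<times> {..b}. card (?X p))"
    by (simp add: sum.cartesian_product count_st_alt case_prod_unfold)
  also have "\<dots> = card (\<Union>p\<in>{..a} \<times> {..b}. ?X p)"
  proof (rule card_UN_disjoint[symmetric])
    show "\<forall>p\<in>{..a} \<times> {..b}. finite (?X p)" using finite_conn_graphs by auto
    show "\<forall>p\<in>{..a} \<times> {..b}. \<forall>q\<in>{..a} \<times> {..b}. p \<noteq> q \<longrightarrow> ?X p \<inter> ?X q = {}"
    proof (intro ballI impI)
      fix p q :: "nat \<times> nat" assume "p \<noteq> q"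
      show "?X p \<inter> ?X q = {}"
      proof (rule ccontr)
        assume "?X p \<inter> ?X q \<noteq> {}"
        then obtain E E' where "E \<in> conn_graphs n" "E' \<in> conn_graphs n" "iso_class n E = iso_class n E'"
          "p = (sib n E, tuft n E)" "q = (sib n E', tuft n E')" by (cases p; cases q) auto
        then show False using sib_tuft_iso_class[of E n E'] \<open>p \<noteq> q\<close> by simp
      qed
    qed
  qed simp
  also have "(\<Union>p\<in>{..a} \<times> {..b}. ?X p) = iso_class n ` {E \<in> conn_graphs n. sib n E \<le> a \<and> tuft n E \<le> b}"
    by auto
  finally show ?thesis .
qed

lemma zero_if_partial_sums_zero:
  fixes f :: "nat \<Rightarrow> int"
  assumes "\<And>a. (\<Sum>i\<le>a. f i) = 0" shows "f a = 0"
  using assms[of a] assms[of "a - 1"] by (cases a) auto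

text \<open>The excluded case: the only graph is a single edge, whose ends are twins and leaves at
  once, so both numbers are 1.\<close>

lemma conn_graphs_2:
  assumes "E \<in> conn_graphs 2" shows "sib 2 E = tuft 2 E"
proof -
  have s: "E \<in> simple_graphs 2" and conn: "conn_cgraph (of_edges 2 E)" using assms conn_graphsD by auto
  have l2: "{..<2} = {0, 1::nat}" by auto
  have E: "E \<subseteq> {{0, 1}}"
  proof
    fix e assume "e \<in> E"
    then obtain u v where "e = {u, v}" "u < 2" "v < 2" "u \<noteq> v" using simple_graphs_edge[OF s] by metis
    then have "u = 0 \<and> v = 1 \<or> u = 1 \<and> v = 0" by linarith
    then show "e \<in> {{0, 1}}" using \<open>e = {u, v}\<close> by auto
  qed
  moreover have "E \<noteq> {}"
  proof
    assume "E = {}"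
    then have "vs (of_edges 2 E) = {0}" by (intro closed_set_eq_vs[OF conn]) auto
    then have "1 \<in> {0::nat}" by (metis of_edges_simps(1) l2 insertI1 insert_commute)
    then show False by simp
  qed
  ultimately have E_eq: "E = {{0, 1}}" by blast
  have nb: "nbhd E 0 = {1}" "nbhd E 1 = {0}"
    unfolding E_eq nbhd_def doubleton_eq_iff singleton_iff by auto
  have cn: "closed_nbhd E u = {0, 1}" if "u \<in> {..<2}" for u
  proof -
    have "u = 0 \<or> u = 1" using that by auto
    then show ?thesis unfolding closed_nbhd_def using nb by (metis insert_commute)
  qed
  have "{u \<in> {..<2}. closed_nbhd E u = closed_nbhd E v} = {..<2}" if "v \<in> {..<2}" for v
    using cn cn[OF that] by blast
  then have "(\<lambda>v. card {u \<in> {..<2}. closed_nbhd E u = closed_nbhd E v}) ` {..<2} = (\<lambda>v. 2) ` {..<2::nat}"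
    by (intro image_cong refl) simp
  then have "sib 2 E = 1" unfolding sib_def l2 by simp
  moreover have "{u \<in> nbhd E v. is_leaf E u} = nbhd E v" if "v \<in> {..<2}" for v
  proof -
    have "v = 0 \<or> v = 1" using that by auto
    then have "nbhd E v = {1} \<or> nbhd E v = {0}" by (elim disjE) (simp_all only: nb simp_thms)
    moreover have "is_leaf E 0" "is_leaf E 1" unfolding is_leaf_def nb by simp_all
    ultimately have "is_leaf E u" if "u \<in> nbhd E v" for u using that by (metis singletonD)
    then show ?thesis by blast
  qed
  then have "(\<lambda>v. card {u \<in> nbhd E v. is_leaf E u}) ` {..<2} = (\<lambda>v. card (nbhd E v)) ` {..<2}"
    by (intro image_cong refl) simp
  then have "tuft 2 E = 1" unfolding tuft_def l2 using nb by simp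
  ultimately show ?thesis by simp
qed

theorem theorem1p1:
  fixes n :: nat
  assumes "n \<ge> 1"
  shows "\<forall>a b. count_st n a b = count_st n b a"
proof (cases "n = 2")
  case True
  \<comment> \<open>With two vertices the all-plain content is the excluded one, but here both
    numbers coincide, so every count off the diagonal vanishes.\<close>
  have "count_st 2 a b = 0" if "a \<noteq> b" for a b
  proof -
    have "{E \<in> conn_graphs 2. sib 2 E = a \<and> tuft 2 E = b} = {}" using conn_graphs_2 that by blast
    then show ?thesis unfolding count_st_alt by (metis card.empty image_empty)
  qed
  then show ?thesis using True by metis
next
  case False
  then have "replicate_mset n 0 \<noteq> {#0, 0::nat#}" by (metis size_replicate_mset size_add_mset size_empty numeral_2_eq_2)
  then have rect: "(\<Sum>i\<le>a. \<Sum>j\<le>b. count_st n i j) = (\<Sum>i\<le>b. \<Sum>j\<le>a. count_st n i j)" for a b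
    unfolding sum_count_st card_bounded_classes by (rule card_types_bounded_sym)
  \<comment> \<open>Symmetry of the bounded counts says that this antisymmetric difference has sum 0
    over every rectangle; integers avoid truncated subtraction.\<close>
  define h where "h i j = int (count_st n i j) - int (count_st n j i)" for i j
  have "(\<Sum>i\<le>a. \<Sum>j\<le>b. h i j) = 0" for a b
  proof -
    have "(\<Sum>i\<le>a. \<Sum>j\<le>b. count_st n i j) = (\<Sum>i\<le>a. \<Sum>j\<le>b. count_st n j i)"
      unfolding rect by (rule sum.swap)
    then have "int (\<Sum>i\<le>a. \<Sum>j\<le>b. count_st n i j) = int (\<Sum>i\<le>a. \<Sum>j\<le>b. count_st n j i)" by simp
    then show ?thesis by (simp add: h_def sum_subtractf)
  qed
  \<comment> \<open>Differencing in the first index isolates the partial sums of a row; differencing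
    once more in the second isolates the entry.\<close>
  then have "(\<Sum>j\<le>b. h a j) = 0" for a b by (rule zero_if_partial_sums_zero)
  then have "h a b = 0" for a b by (rule zero_if_partial_sums_zero)
  then show ?thesis by (simp add: h_def)
qed

end
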